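(* Let $G$ be a finite group and $H \le G$ a subgroup. For $h\in H$ write $(h)_H$, $(h)_G$ for the conjugacy classes of $h$ in $H$ and in $G$, and $(h)_H^{\pm}=(h)_H\cup(h^{-1})_H$, $(h)_G^{\pm}=(h)_G\cup(h^{-1})_G$. Then: (1) The induction homomorphism $\operatorname{Ind}_H^G:\operatorname{R}(H)\to\operatorname{R}(G)$ is a monomorphism if and only if $(h)_G\cap H=(h)_H$ for every $h\in H$. (2) The induction homomorphism $\operatorname{Ind}_H^G:\operatorname{RO}(H)\to\operatorname{RO}(G)$ is a monomorphism if and only if $(h)_G^{\pm}\cap H=(h)_H^{\pm}$ for every $h\in H$.
   Context: All groups are finite. $\operatorname{R}(K)$ denotes the complex representation group of $K$ (Grothendieck group of finite-dimensional $\mathbb{C}K$-modules under direct sum) and $\operatorname{RO}(K)$ the real representation group (same for $\mathbb{R}K$-modules), regarded as a subgroup of $\operatorname{R}(K)$ via complexification; $\operatorname{Ind}_H^G$ is induction of representations. The set $(g)^{\pm}=(g)\cup(g^{-1})$ is called the real conjugacy class of $g$. *)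

theory Defs
  imports "HOL-Algebra.Group" "HOL-Algebra.Coset" "Jordan_Normal_Form.Matrix"
begin

text \<open>A (complex, finite-dimensional) representation of a group K is encoded as a pair
  (n, rho): its degree n and a homomorphism rho from K into invertible n x n complex matrices.\<close>

type_synonym 'g crep = "nat \<times> ('g \<Rightarrow> complex mat)"

definition is_rep :: "('g, 'b) monoid_scheme \<Rightarrow> 'g crep \<Rightarrow> bool" where
  "is_rep K V \<longleftrightarrow>
     (\<forall>g\<in>carrier K. snd V g \<in> carrier_mat (fst V) (fst V)) \<and>
     snd V \<one>\<^bsub>K\<^esub> = 1\<^sub>m (fst V) \<and>
     (\<forall>g\<in>carrier K. \<forall>h\<in>carrier K. snd V (g \<otimes>\<^bsub>K\<^esub> h) = snd V g * snd V h)"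

text \<open>Complexification of a real representation: all matrix entries are real.\<close>
definition is_real_rep :: "('g, 'b) monoid_scheme \<Rightarrow> 'g crep \<Rightarrow> bool" where
  "is_real_rep K V \<longleftrightarrow> is_rep K V \<and>
     (\<forall>g\<in>carrier K. \<forall>i<fst V. \<forall>j<fst V. snd V g $$ (i, j) \<in> \<real>)"

definition rep_iso :: "('g, 'b) monoid_scheme \<Rightarrow> 'g crep \<Rightarrow> 'g crep \<Rightarrow> bool" where
  "rep_iso K V W \<longleftrightarrow> fst V = fst W \<and>
     (\<exists>P \<in> carrier_mat (fst V) (fst V). invertible_mat P \<and>
        (\<forall>g\<in>carrier K. P * snd V g = snd W g * P))"

definition rep_sum :: "'g crep \<Rightarrow> 'g crep \<Rightarrow> 'g crep" where
  "rep_sum V W = (fst V + fst W,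
     \<lambda>g. four_block_mat (snd V g) (0\<^sub>m (fst V) (fst W)) (0\<^sub>m (fst W) (fst V)) (snd W g))"

text \<open>Equality in the Grothendieck group R(K): the formal differences [V]-[W] and [V']-[W']
  coincide iff V + W' + U is isomorphic to V' + W + U for some representation U.\<close>
definition groth_eq :: "('g, 'b) monoid_scheme \<Rightarrow> 'g crep \<times> 'g crep \<Rightarrow> 'g crep \<times> 'g crep \<Rightarrow> bool" where
  "groth_eq K x y \<longleftrightarrow> (\<exists>U. is_rep K U \<and>
     rep_iso K (rep_sum (rep_sum (fst x) (snd y)) U) (rep_sum (rep_sum (fst y) (snd x)) U))"

definition transversal :: "('g, 'b) monoid_scheme \<Rightarrow> 'g set \<Rightarrow> 'g list \<Rightarrow> bool" where
  "transversal G H ts \<longleftrightarrow> set ts \<subseteq> carrier G \<and>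
     (\<forall>g\<in>carrier G. \<exists>!i. i < length ts \<and> inv\<^bsub>G\<^esub> (ts ! i) \<otimes>\<^bsub>G\<^esub> g \<in> H)"

text \<open>Induced representation Ind_H^G V, realised on the direct sum of copies t_i V:
  block (i,j) of the matrix of g is rho(t_i^-1 g t_j) if this lies in H, and 0 otherwise.\<close>
definition induce :: "('g, 'b) monoid_scheme \<Rightarrow> 'g set \<Rightarrow> 'g crep \<Rightarrow> 'g crep" where
  "induce G H V = (let ts = (SOME ts. transversal G H ts); m = length ts; n = fst V in
     (m * n, \<lambda>g. mat (m * n) (m * n) (\<lambda>(r, c).
        let i = r div n; a = r mod n; j = c div n; b = c mod n;
            x = inv\<^bsub>G\<^esub> (ts ! i) \<otimes>\<^bsub>G\<^esub> g \<otimes>\<^bsub>G\<^esub> (ts ! j)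
        in if x \<in> H then snd V x $$ (a, b) else 0)))"

definition ind_R_mono :: "('g, 'b) monoid_scheme \<Rightarrow> 'g set \<Rightarrow> bool" where
  "ind_R_mono G H \<longleftrightarrow> (\<forall>V W V' W'.
     is_rep (G\<lparr>carrier := H\<rparr>) V \<and> is_rep (G\<lparr>carrier := H\<rparr>) W \<and>
     is_rep (G\<lparr>carrier := H\<rparr>) V' \<and> is_rep (G\<lparr>carrier := H\<rparr>) W' \<and>
     groth_eq G (induce G H V, induce G H W) (induce G H V', induce G H W') \<longrightarrow>
     groth_eq (G\<lparr>carrier := H\<rparr>) (V, W) (V', W'))"

text \<open>Ind_H^G : RO(H) -> RO(G) is injective, RO regarded inside R via complexification.\<close>
definition ind_RO_mono :: "('g, 'b) monoid_scheme \<Rightarrow> 'g set \<Rightarrow> bool" where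
  "ind_RO_mono G H \<longleftrightarrow> (\<forall>V W V' W'.
     is_real_rep (G\<lparr>carrier := H\<rparr>) V \<and> is_real_rep (G\<lparr>carrier := H\<rparr>) W \<and>
     is_real_rep (G\<lparr>carrier := H\<rparr>) V' \<and> is_real_rep (G\<lparr>carrier := H\<rparr>) W' \<and>
     groth_eq G (induce G H V, induce G H W) (induce G H V', induce G H W') \<longrightarrow>
     groth_eq (G\<lparr>carrier := H\<rparr>) (V, W) (V', W'))"

definition conj_class :: "('g, 'b) monoid_scheme \<Rightarrow> 'g \<Rightarrow> 'g set" where
  "conj_class K h = {x \<otimes>\<^bsub>K\<^esub> h \<otimes>\<^bsub>K\<^esub> inv\<^bsub>K\<^esub> x | x. x \<in> carrier K}"

definition real_conj_class :: "('g, 'b) monoid_scheme \<Rightarrow> 'g \<Rightarrow> 'g set" where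
  "real_conj_class K h = conj_class K h \<union> conj_class K (inv\<^bsub>K\<^esub> h)"

end

theory Submission
  imports Defs "Jordan_Normal_Form.Determinant" "HOL-Algebra.Multiplicative_Group"
begin

text \<open>Over \<open>\<complex>\<close>, representations with equal characters are isomorphic, so everything can be read off
  characters. To see this, average an arbitrary matrix to an intertwiner \<open>X : V \<rightarrow> W\<close>. If all of them
  vanished then \<open>\<Sum>\<^sub>g |\<chi>(g)|\<^sup>2 = 0\<close>; a nonzero one gives, by Maschke's theorem, a common summand of
  \<open>V\<close> and \<open>W\<close>, which is split off by induction on the degree.

  If fusion is trivial, the formula for induced characters shows that \<open>Ind f\<close> at \<open>h \<in> H\<close> is a positive
  multiple of \<open>f h\<close>; for real representations \<open>\<chi>(h\<^sup>-\<^sup>1) = \<chi>(h)\<close> makes the real classes sufficient.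

  Conversely, let \<open>h' = t h t\<^sup>-\<^sup>1 \<in> H\<close>. For a representation \<open>V\<close> of \<open>C = \<langle>h\<rangle>\<close> and its transport \<open>V\<^sup>t\<close> to
  \<open>C' = t C t\<^sup>-\<^sup>1\<close>, the representations \<open>Ind\<^sub>C V\<close> and \<open>Ind\<^sub>C\<^sub>' V\<^sup>t\<close> of \<open>H\<close> have the same induction to \<open>G\<close>, so
  they agree if induction is injective. Taking the powers of a faithful linear character of \<open>C\<close> (or the
  corresponding plane rotations) and Fourier inversion on \<open>C\<close>, the indicator functions of \<open>h\<close> and \<open>h'\<close>
  (symmetrised under inversion in the real case) have the same induction to \<open>H\<close>, and evaluating
  at \<open>h'\<close> shows that \<open>h\<close> and \<open>h'\<close> are already fused in \<open>H\<close>.\<close>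

section \<open>Matrices\<close>

text \<open>Carrying the inverse \<open>Q\<close> along as data gives calculations an explicit
  matrix to cancel with; \<open>invertible_mat\<close> only asserts that one exists.\<close>

definition mutual_inverse :: "nat \<Rightarrow> 'a::semiring_1 mat \<Rightarrow> 'a mat \<Rightarrow> bool" where
  "mutual_inverse n P Q \<longleftrightarrow> P \<in> carrier_mat n n \<and> Q \<in> carrier_mat n n \<and> P * Q = 1\<^sub>m n \<and> Q * P = 1\<^sub>m n"

lemma mutual_inverse_one: "mutual_inverse n (1\<^sub>m n) (1\<^sub>m n)"
  by (auto simp: mutual_inverse_def)

lemma mutual_inverse_sym: "mutual_inverse n P Q \<Longrightarrow> mutual_inverse n Q P"
  by (auto simp: mutual_inverse_def)

lemma mutual_inverseI:
  fixes P :: "'a::field mat"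
  assumes "P \<in> carrier_mat n n" "Q \<in> carrier_mat n n" "P * Q = 1\<^sub>m n"
  shows "mutual_inverse n P Q"
  using assms mat_mult_left_right_inverse[OF assms] by (auto simp: mutual_inverse_def)

lemma mutual_inverse_mult:
  assumes "mutual_inverse n P P'" "mutual_inverse n Q Q'"
  shows "mutual_inverse n (P * Q) (Q' * P')"
proof -
  have *: "A * B * (B' * A') = 1\<^sub>m n"
    if "mutual_inverse n A A'" "mutual_inverse n B B'" for A A' B B' :: "'a mat"
  proof -
    have c: "A \<in> carrier_mat n n" "A' \<in> carrier_mat n n" "B \<in> carrier_mat n n" "B' \<in> carrier_mat n n"
      using that by (auto simp: mutual_inverse_def)
    have "A * B * (B' * A') = A * (B * B') * A'"
      using c by (simp add: assoc_mult_mat[of _ n n _ n _ n])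
    also have "\<dots> = 1\<^sub>m n"
      using that c by (simp add: mutual_inverse_def)
    finally show ?thesis .
  qed
  show ?thesis
    using assms *[OF assms] *[OF mutual_inverse_sym[OF assms(2)] mutual_inverse_sym[OF assms(1)]]
    by (auto simp: mutual_inverse_def)
qed

lemma mutual_inverse_block:
  assumes "mutual_inverse n P P'" "mutual_inverse m Q Q'"
  shows "mutual_inverse (n + m) (four_block_mat P (0\<^sub>m n m) (0\<^sub>m m n) Q)
           (four_block_mat P' (0\<^sub>m n m) (0\<^sub>m m n) Q')"
  using assms by (auto simp: mutual_inverse_def mult_four_block_mat[of _ n n _ m _ m _ _ n _ m])

lemma uminus_zero_mat [simp]: "- 0\<^sub>m n m = (0\<^sub>m n m :: 'a::group_add mat)"
  by (intro eq_matI) auto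

lemma add_uminus_mat: "(A :: 'a::group_add mat) \<in> carrier_mat n m \<Longrightarrow> A + - A = 0\<^sub>m n m"
  by (intro eq_matI) auto

text \<open>Block matrices of this shape multiply by adding their corners, so \<open>X\<close> and
  \<open>- X\<close> cancel. Elimination below a pivot uses such a matrix, and so does the change of
  basis in Maschke's theorem.\<close>

lemma mutual_inverse_shear:
  fixes X :: "'a::field mat"
  assumes "X \<in> carrier_mat m n"
  shows "mutual_inverse (n + m) (four_block_mat (1\<^sub>m n) (0\<^sub>m n m) X (1\<^sub>m m))
           (four_block_mat (1\<^sub>m n) (0\<^sub>m n m) (- X) (1\<^sub>m m))"
  using assms
  by (intro mutual_inverseI) (auto simp: add_uminus_mat mult_four_block_mat[of _ n n _ m _ m _ _ n _ m])

lemma invertible_mat_iff_mutual_inverse: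
  assumes "P \<in> carrier_mat n n"
  shows "invertible_mat P \<longleftrightarrow> (\<exists>Q. mutual_inverse n P Q)"
proof
  assume "invertible_mat P"
  then obtain Q where Q: "P * Q = 1\<^sub>m n" "Q * P = 1\<^sub>m (dim_row Q)"
    using assms by (auto simp: invertible_mat_def inverts_mat_def)
  have "dim_col (P * Q) = n" "dim_col (Q * P) = dim_row Q" by (simp_all only: Q) simp_all
  then have "Q \<in> carrier_mat n n" using assms by auto
  with Q assms show "\<exists>Q. mutual_inverse n P Q" by (auto simp: mutual_inverse_def)
next
  assume "\<exists>Q. mutual_inverse n P Q"
  then show "invertible_mat P"
    using assms by (auto simp: invertible_mat_def inverts_mat_def mutual_inverse_def)
qed

lemma mat_split_blocks:
  assumes "A \<in> carrier_mat (n1 + n2) (m1 + m2)"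
  obtains A1 A2 A3 A4 where
    "A1 \<in> carrier_mat n1 m1" "A2 \<in> carrier_mat n1 m2"
    "A3 \<in> carrier_mat n2 m1" "A4 \<in> carrier_mat n2 m2"
    "A = four_block_mat A1 A2 A3 A4"
proof -
  obtain A1 A2 A3 A4 where "split_block A n1 m1 = (A1, A2, A3, A4)"
    by (metis prod_cases4)
  from split_block[OF this, of n2 m2] assms that show ?thesis by auto
qed

lemma four_block_mat_eq_iff:
  assumes "A \<in> carrier_mat n1 m1" "B \<in> carrier_mat n1 m2" "C \<in> carrier_mat n2 m1" "D \<in> carrier_mat n2 m2"
    "A' \<in> carrier_mat n1 m1" "B' \<in> carrier_mat n1 m2" "C' \<in> carrier_mat n2 m1" "D' \<in> carrier_mat n2 m2"
  shows "four_block_mat A B C D = four_block_mat A' B' C' D' \<longleftrightarrow> A = A' \<and> B = B' \<and> C = C' \<and> D = D'"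
proof
  assume eq: "four_block_mat A B C D = four_block_mat A' B' C' D'"
  have ent: "four_block_mat A B C D $$ (i, j) = four_block_mat A' B' C' D' $$ (i, j)" for i j
    by (simp add: eq)
  have "A = A'"
  proof (intro eq_matI)
    fix i j assume "i < dim_row A'" "j < dim_col A'"
    then show "A $$ (i, j) = A' $$ (i, j)" using ent[of i j] assms by auto
  qed (use assms in auto)
  moreover have "B = B'"
  proof (intro eq_matI)
    fix i j assume "i < dim_row B'" "j < dim_col B'"
    then show "B $$ (i, j) = B' $$ (i, j)" using ent[of i "j + m1"] assms by auto
  qed (use assms in auto)
  moreover have "C = C'"
  proof (intro eq_matI)
    fix i j assume "i < dim_row C'" "j < dim_col C'"
    then show "C $$ (i, j) = C' $$ (i, j)" using ent[of "i + n1" j] assms by auto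
  qed (use assms in auto)
  moreover have "D = D'"
  proof (intro eq_matI)
    fix i j assume "i < dim_row D'" "j < dim_col D'"
    then show "D $$ (i, j) = D' $$ (i, j)" using ent[of "i + n1" "j + m1"] assms by auto
  qed (use assms in auto)
  ultimately show "A = A' \<and> B = B' \<and> C = C' \<and> D = D'" by blast
qed auto

section \<open>Rank normal form over a field\<close>

definition mat_equiv :: "nat \<Rightarrow> 'a::semiring_1 mat \<Rightarrow> 'a mat \<Rightarrow> bool" where
  "mat_equiv n A B \<longleftrightarrow> (\<exists>P P' Q Q'. mutual_inverse n P P' \<and> mutual_inverse n Q Q' \<and> B = P * A * Q)"

lemma mat_equivI:
  "mutual_inverse n P P' \<Longrightarrow> mutual_inverse n Q Q' \<Longrightarrow> B = P * A * Q \<Longrightarrow> mat_equiv n A B"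
  by (auto simp: mat_equiv_def)

lemma mat_equiv_trans:
  assumes "mat_equiv n A B" "mat_equiv n B C" "A \<in> carrier_mat n n"
  shows "mat_equiv n A C"
proof -
  obtain P P' Q Q' where 1: "mutual_inverse n P P'" "mutual_inverse n Q Q'" "B = P * A * Q"
    using assms(1) by (auto simp: mat_equiv_def)
  obtain R R' S S' where 2: "mutual_inverse n R R'" "mutual_inverse n S S'" "C = R * B * S"
    using assms(2) by (auto simp: mat_equiv_def)
  have "C = (R * P) * A * (Q * S)"
    using 1 2 assms(3) unfolding mutual_inverse_def
    by (auto simp: assoc_mult_mat[of _ n n _ n _ n] intro!: mult_carrier_mat[of _ n n])
  then show ?thesis
    using mat_equivI[OF mutual_inverse_mult[OF 2(1) 1(1)] mutual_inverse_mult[OF 1(2) 2(2)]] by simp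
qed

text \<open>The rank is \<open>r\<close>. The block form lets products with this matrix be computed
  by block multiplication alone.\<close>

definition partial_identity :: "nat \<Rightarrow> nat \<Rightarrow> 'a::zero_neq_one mat" where
  "partial_identity r s = four_block_mat (1\<^sub>m r) (0\<^sub>m r s) (0\<^sub>m s r) (0\<^sub>m s s)"

text \<open>One row swap and one column swap move a nonzero entry to the corner; swap matrices are
  their own inverses.\<close>

lemma mat_equiv_nonzero_corner:
  fixes A :: "'a::field mat"
  assumes A: "A \<in> carrier_mat (Suc n) (Suc n)" and nz: "A \<noteq> 0\<^sub>m (Suc n) (Suc n)"
  obtains B where "mat_equiv (Suc n) A B" "B \<in> carrier_mat (Suc n) (Suc n)" "B $$ (0, 0) \<noteq> 0"
proof -
  obtain i j where ij: "i < Suc n" "j < Suc n" "A $$ (i, j) \<noteq> 0"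
    using nz A by (metis carrier_matD eq_matI index_zero_mat)
  let ?S = "\<lambda>k. swaprows_mat (Suc n) 0 k :: 'a mat"
  have inv: "mutual_inverse (Suc n) (?S k) (?S k)" if "k < Suc n" for k
    using swaprows_mat_inv[of 0 "Suc n" k] that by (intro mutual_inverseI) auto
  have swap: "?S i * A = swaprows 0 i A"
    using swaprows_mat[OF A, of 0 i] ij by simp
  have "(?S i * A * ?S j) $$ (0, 0) = row (?S i * A) 0 \<bullet> col (?S j) 0"
    using A ij by simp
  also have "col (?S j) 0 = unit_vec (Suc n) j"
    using ij by (intro eq_vecI) (auto simp: unit_vec_def)
  also have "row (?S i * A) 0 \<bullet> unit_vec (Suc n) j = A $$ (i, j)"
    unfolding swap using A ij by (subst scalar_prod_right_unit[of _ "Suc n"]) auto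
  finally have nz: "(?S i * A * ?S j) $$ (0, 0) \<noteq> 0" using ij by simp
  show ?thesis
    using A by (intro that[OF mat_equivI[OF inv[OF ij(1)] inv[OF ij(2)] refl, of A] _ nz]) auto
qed

text \<open>Gaussian elimination by induction on the size: a nonzero pivot in the corner clears its
  row and column, and the induction hypothesis handles the remaining block.\<close>

lemma rank_normal_form:
  fixes A :: "'a::field mat"
  assumes "A \<in> carrier_mat n n"
  shows "\<exists>r s. n = r + s \<and> mat_equiv n A (partial_identity r s)"
  using assms
proof (induction n arbitrary: A)
  case 0
  then have "A = partial_identity 0 0"
    by (intro eq_matI) (auto simp: partial_identity_def)
  then have "mat_equiv 0 A (partial_identity 0 0)"
    using 0 by (intro mat_equivI[OF mutual_inverse_one mutual_inverse_one]) auto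
  then show ?case by auto
next
  case (Suc n)
  show ?case
  proof (cases "A = 0\<^sub>m (Suc n) (Suc n)")
    case True
    then have "A = partial_identity 0 (Suc n)"
      by (intro eq_matI) (auto simp: partial_identity_def)
    then have "mat_equiv (Suc n) A (partial_identity 0 (Suc n))"
      using Suc.prems by (intro mat_equivI[OF mutual_inverse_one mutual_inverse_one]) auto
    then show ?thesis by (metis add_0)
  next
    case False
    then obtain B where AB: "mat_equiv (Suc n) A B" and B: "B \<in> carrier_mat (1 + n) (1 + n)"
      and B0: "B $$ (0, 0) \<noteq> 0"
      using mat_equiv_nonzero_corner[OF Suc.prems] by auto
    from B obtain a b c d where a: "a \<in> carrier_mat 1 1" and b: "b \<in> carrier_mat 1 n"
      and c: "c \<in> carrier_mat n 1" and d: "d \<in> carrier_mat n n" and Beq: "B = four_block_mat a b c d"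
      by (rule mat_split_blocks)
    \<comment> \<open>The inverse of the pivot, kept as a 1 by 1 matrix so that the elimination is a
      product of block matrices.\<close>
    define a' where "a' = mat 1 1 (\<lambda>_. 1 / B $$ (0, 0))"
    have a': "a' \<in> carrier_mat 1 1" by (simp add: a'_def)
    have a0: "a $$ (0, 0) = B $$ (0, 0)" using a d by (simp add: Beq)
    have aa: "a * a' = 1\<^sub>m 1" "a' * a = 1\<^sub>m 1"
      using a B0 by (auto intro!: eq_matI simp: scalar_prod_def a'_def a0)
    \<comment> \<open>\<open>L\<close> subtracts multiples of the first row to clear the column
      below the pivot; \<open>R\<close> scales the pivot to 1 and clears the row to its
      right.\<close>
    define L where "L = four_block_mat (1\<^sub>m 1) (0\<^sub>m 1 n) (- (c * a')) (1\<^sub>m n)"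
    define L' where "L' = four_block_mat (1\<^sub>m 1) (0\<^sub>m 1 n) (c * a') (1\<^sub>m n)"
    define R where "R = four_block_mat a' (- (a' * b)) (0\<^sub>m n 1) (1\<^sub>m n)"
    define R' where "R' = four_block_mat a b (0\<^sub>m n 1) (1\<^sub>m n)"
    have LL: "mutual_inverse (1 + n) L L'"
      unfolding L_def L'_def using a' c by (intro mutual_inverse_shear[THEN mutual_inverse_sym]) auto
    have RR: "mutual_inverse (1 + n) R' R"
      unfolding R_def R'_def using a a' b aa
      by (intro mutual_inverseI)
        (auto simp: mult_four_block_mat[of _ 1 1 _ n _ n _ _ 1 _ n] assoc_mult_mat[symmetric, of _ 1 1 _ 1 _ n])
    \<comment> \<open>The Schur complement of the pivot.\<close>
    define e where "e = - (c * a') * b + d"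
    have e: "e \<in> carrier_mat n n" using a' b c d by (auto simp: e_def)
    have ca: "c * a' * a = c"
      using a a' c aa by (simp add: assoc_mult_mat[of _ n 1 _ 1 _ 1])
    have "L * B = four_block_mat a b (0\<^sub>m n 1) e"
      unfolding L_def Beq e_def using a a' b c d ca
      by (simp add: mult_four_block_mat[of _ 1 1 _ n _ n _ _ 1 _ n])
    then have LBR: "L * B * R = four_block_mat (1\<^sub>m 1) (0\<^sub>m 1 n) (0\<^sub>m n 1) e"
      unfolding R_def using a a' b c e aa
      by (simp add: mult_four_block_mat[of _ 1 1 _ n _ n _ _ 1 _ n] assoc_mult_mat[symmetric, of _ 1 1 _ 1 _ n])
    have "mat_equiv (1 + n) B (four_block_mat (1\<^sub>m 1) (0\<^sub>m 1 n) (0\<^sub>m n 1) e)"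
      using mat_equivI[OF LL mutual_inverse_sym[OF RR]] LBR by metis
    then have 1: "mat_equiv (Suc n) A (four_block_mat (1\<^sub>m 1) (0\<^sub>m 1 n) (0\<^sub>m n 1) e)"
      using mat_equiv_trans[OF AB] Suc.prems by simp
    obtain r s P P' Q Q' where rs: "n = r + s" and PQ: "mutual_inverse n P P'" "mutual_inverse n Q Q'"
      and I: "partial_identity r s = P * e * Q"
      using Suc.IH[OF e] by (auto simp: mat_equiv_def)
    \<comment> \<open>The equivalence found for \<open>e\<close> is extended by 1 on the pivot,
      which raises the rank by one.\<close>
    have "partial_identity (Suc r) s = four_block_mat (1\<^sub>m 1) (0\<^sub>m 1 n) (0\<^sub>m n 1) (partial_identity r s)"
      by (intro eq_matI) (auto simp: partial_identity_def rs)
    also have "\<dots> = four_block_mat (1\<^sub>m 1) (0\<^sub>m 1 n) (0\<^sub>m n 1) P *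
        four_block_mat (1\<^sub>m 1) (0\<^sub>m 1 n) (0\<^sub>m n 1) e * four_block_mat (1\<^sub>m 1) (0\<^sub>m 1 n) (0\<^sub>m n 1) Q"
      using e PQ by (auto simp: mult_four_block_mat[of _ 1 1 _ n _ n _ _ 1 _ n] I mutual_inverse_def)
    finally have "mat_equiv (1 + n) (four_block_mat (1\<^sub>m 1) (0\<^sub>m 1 n) (0\<^sub>m n 1) e) (partial_identity (Suc r) s)"
      using mat_equivI mutual_inverse_block[OF mutual_inverse_one PQ(1)]
        mutual_inverse_block[OF mutual_inverse_one PQ(2)] by metis
    then have "mat_equiv (Suc n) A (partial_identity (Suc r) s)"
      using mat_equiv_trans[OF 1] Suc.prems by simp
    then show ?thesis using rs by (metis add_Suc)
  qed
qed

section \<open>Traces and sums of families of matrices\<close>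

lemma index_mult_mat_sum:
  assumes "A \<in> carrier_mat n k" "B \<in> carrier_mat k m" "i < n" "j < m"
  shows "(A * B) $$ (i, j) = (\<Sum>l<k. A $$ (i, l) * B $$ (l, j))"
  using assms by (auto simp: scalar_prod_def atLeast0LessThan intro!: sum.cong)

definition mat_trace :: "'a::comm_monoid_add mat \<Rightarrow> 'a" where
  "mat_trace A = (\<Sum>i<dim_row A. A $$ (i, i))"

lemma mat_trace_mult_commute:
  fixes A :: "'a::comm_semiring_0 mat"
  assumes "A \<in> carrier_mat n m" "B \<in> carrier_mat m n"
  shows "mat_trace (A * B) = mat_trace (B * A)"
proof -
  have "mat_trace (A * B) = (\<Sum>i<n. \<Sum>j<m. A $$ (i, j) * B $$ (j, i))"
    using assms by (auto simp: mat_trace_def scalar_prod_def atLeast0LessThan intro!: sum.cong)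
  also have "\<dots> = (\<Sum>j<m. \<Sum>i<n. B $$ (j, i) * A $$ (i, j))"
    by (subst sum.swap) (simp add: mult.commute)
  also have "\<dots> = mat_trace (B * A)"
    using assms by (auto simp: mat_trace_def scalar_prod_def atLeast0LessThan intro!: sum.cong)
  finally show ?thesis .
qed

lemma mat_trace_four_block:
  assumes "A \<in> carrier_mat n n" "D \<in> carrier_mat m m"
  shows "mat_trace (four_block_mat A B C D) = mat_trace A + mat_trace D"
proof -
  have "mat_trace (four_block_mat A B C D) =
      (\<Sum>i<n + m. if i < n then A $$ (i, i) else D $$ (i - n, i - n))"
    using assms by (auto simp: mat_trace_def intro!: sum.cong)
  also have "\<dots> = (\<Sum>i<n. A $$ (i, i)) + (\<Sum>i<m. D $$ (i, i))"
    by (induction m) (simp_all add: add.assoc)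
  also have "\<dots> = mat_trace A + mat_trace D" using assms by (auto simp: mat_trace_def)
  finally show ?thesis .
qed

lemma mat_trace_one [simp]: "mat_trace (1\<^sub>m n) = of_nat n"
  by (simp add: mat_trace_def)

text \<open>The dimensions are arguments because the type \<open>mat\<close> does not record them;
  thus even an empty sum has a shape.\<close>

definition sum_mat :: "nat \<Rightarrow> nat \<Rightarrow> ('i \<Rightarrow> 'a::comm_monoid_add mat) \<Rightarrow> 'i set \<Rightarrow> 'a mat" where
  "sum_mat n m F S = mat n m (\<lambda>ij. \<Sum>x\<in>S. F x $$ ij)"

lemma sum_mat_carrier[simp]: "sum_mat n m F S \<in> carrier_mat n m"
  by (simp add: sum_mat_def)

lemma sum_mat_cong: "(\<And>x. x \<in> S \<Longrightarrow> F x = F' x) \<Longrightarrow> sum_mat n m F S = sum_mat n m F' S"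
  by (simp add: sum_mat_def)

lemma sum_mat_reindex: "bij_betw h S T \<Longrightarrow> sum_mat n m (\<lambda>x. F (h x)) S = sum_mat n m F T"
  unfolding sum_mat_def by (intro cong_mat) (auto intro!: sum.reindex_bij_betw)

lemma mult_sum_mat:
  fixes A :: "'a::semiring_0 mat"
  assumes "A \<in> carrier_mat k n" "\<And>x. x \<in> S \<Longrightarrow> F x \<in> carrier_mat n m"
  shows "A * sum_mat n m F S = sum_mat k m (\<lambda>x. A * F x) S"
proof (intro eq_matI)
  fix i j assume "i < dim_row (sum_mat k m (\<lambda>x. A * F x) S)" "j < dim_col (sum_mat k m (\<lambda>x. A * F x) S)"
  then have ij: "i < k" "j < m" by (auto simp: sum_mat_def)
  have "(A * sum_mat n m F S) $$ (i, j) = (\<Sum>l<n. A $$ (i, l) * (\<Sum>x\<in>S. F x $$ (l, j)))"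
    using assms ij by (auto simp: sum_mat_def scalar_prod_def atLeast0LessThan intro!: sum.cong)
  also have "\<dots> = (\<Sum>x\<in>S. \<Sum>l<n. A $$ (i, l) * F x $$ (l, j))"
    by (subst sum.swap) (simp add: sum_distrib_left)
  also have "\<dots> = (\<Sum>x\<in>S. (A * F x) $$ (i, j))"
    using assms ij by (intro sum.cong refl) (simp add: index_mult_mat_sum[of _ k n _ m])
  finally show "(A * sum_mat n m F S) $$ (i, j) = sum_mat k m (\<lambda>x. A * F x) S $$ (i, j)"
    using ij by (simp add: sum_mat_def)
qed (use assms in \<open>auto simp: sum_mat_def\<close>)

lemma sum_mat_mult:
  fixes A :: "'a::semiring_0 mat"
  assumes "A \<in> carrier_mat m k" "\<And>x. x \<in> S \<Longrightarrow> F x \<in> carrier_mat n m"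
  shows "sum_mat n m F S * A = sum_mat n k (\<lambda>x. F x * A) S"
proof (intro eq_matI)
  fix i j assume "i < dim_row (sum_mat n k (\<lambda>x. F x * A) S)" "j < dim_col (sum_mat n k (\<lambda>x. F x * A) S)"
  then have ij: "i < n" "j < k" by (auto simp: sum_mat_def)
  have "(sum_mat n m F S * A) $$ (i, j) = (\<Sum>l<m. (\<Sum>x\<in>S. F x $$ (i, l)) * A $$ (l, j))"
    using assms ij by (auto simp: sum_mat_def scalar_prod_def atLeast0LessThan intro!: sum.cong)
  also have "\<dots> = (\<Sum>x\<in>S. \<Sum>l<m. F x $$ (i, l) * A $$ (l, j))"
    by (subst sum.swap) (simp add: sum_distrib_right)
  also have "\<dots> = (\<Sum>x\<in>S. (F x * A) $$ (i, j))"
    using assms ij by (intro sum.cong refl) (simp add: index_mult_mat_sum[of _ n m _ k])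
  finally show "(sum_mat n m F S * A) $$ (i, j) = sum_mat n k (\<lambda>x. F x * A) S $$ (i, j)"
    using ij by (simp add: sum_mat_def)
qed (use assms in \<open>auto simp: sum_mat_def\<close>)

lemma sum_mat_add:
  assumes "\<And>x. x \<in> S \<Longrightarrow> F x \<in> carrier_mat n m" "\<And>x. x \<in> S \<Longrightarrow> F' x \<in> carrier_mat n m"
  shows "sum_mat n m (\<lambda>x. F x + F' x) S = sum_mat n m F S + sum_mat n m F' S"
proof -
  have "(F x + F' x) $$ (i, j) = F x $$ (i, j) + F' x $$ (i, j)" if "x \<in> S" "i < n" "j < m" for x i j
    using assms(1)[OF that(1)] assms(2)[OF that(1)] that(2,3) by simp
  then show ?thesis
    by (intro eq_matI) (simp_all add: sum_mat_def sum.distrib)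
qed

lemma sum_mat_const:
  assumes "A \<in> carrier_mat n m"
  shows "sum_mat n m (\<lambda>_. A) S = (of_nat (card S) :: 'a::semiring_1) \<cdot>\<^sub>m A"
  unfolding sum_mat_def using assms by (intro eq_matI) auto

section \<open>Representations and Maschke's theorem\<close>

definition character :: "'g crep \<Rightarrow> 'g \<Rightarrow> complex" where
  "character V g = mat_trace (snd V g)"

lemma is_rep_carrier: "is_rep K V \<Longrightarrow> g \<in> carrier K \<Longrightarrow> snd V g \<in> carrier_mat (fst V) (fst V)"
  by (simp add: is_rep_def)

lemma is_rep_mult:
  "is_rep K V \<Longrightarrow> g \<in> carrier K \<Longrightarrow> h \<in> carrier K \<Longrightarrow> snd V (g \<otimes>\<^bsub>K\<^esub> h) = snd V g * snd V h"
  by (simp add: is_rep_def)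

lemma is_rep_one: "is_rep K V \<Longrightarrow> snd V \<one>\<^bsub>K\<^esub> = 1\<^sub>m (fst V)"
  by (simp add: is_rep_def)

lemma character_one: "is_rep K V \<Longrightarrow> character V \<one>\<^bsub>K\<^esub> = of_nat (fst V)"
  by (simp add: character_def is_rep_one)

section \<open>Isomorphisms and direct sums of representations\<close>

lemma rep_iso_iff:
  "rep_iso K V W \<longleftrightarrow> fst V = fst W \<and>
     (\<exists>P Q. mutual_inverse (fst V) P Q \<and> (\<forall>g\<in>carrier K. P * snd V g = snd W g * P))"
proof -
  have "(P \<in> carrier_mat (fst V) (fst V) \<and> invertible_mat P \<and> R) \<longleftrightarrow>
      (\<exists>Q. mutual_inverse (fst V) P Q \<and> R)" for P R
    using invertible_mat_iff_mutual_inverse[of P "fst V"] by (auto simp: mutual_inverse_def)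
  then show ?thesis unfolding rep_iso_def Bex_def by blast
qed

lemma rep_isoE:
  assumes "rep_iso K V W"
  obtains P Q where "fst W = fst V" "mutual_inverse (fst V) P Q"
    "\<And>g. g \<in> carrier K \<Longrightarrow> P * snd V g = snd W g * P"
  using assms by (auto simp: rep_iso_iff)

lemma rep_isoI:
  assumes "fst V = fst W" "mutual_inverse (fst V) P Q"
    "\<And>g. g \<in> carrier K \<Longrightarrow> P * snd V g = snd W g * P"
  shows "rep_iso K V W"
  using assms by (auto simp: rep_iso_iff)

lemma intertwine_inverse:
  assumes PQ: "mutual_inverse n P Q" and A: "A \<in> carrier_mat n n" and B: "B \<in> carrier_mat n n"
    and eq: "P * A = B * P"
  shows "B = P * A * Q" "Q * B = A * Q"
proof -
  have P: "P \<in> carrier_mat n n" and Q: "Q \<in> carrier_mat n n"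
    and inv: "P * Q = 1\<^sub>m n" "Q * P = 1\<^sub>m n"
    using PQ by (auto simp: mutual_inverse_def)
  have "P * A * Q = B * (P * Q)"
    unfolding eq by (rule assoc_mult_mat[OF B P Q])
  then show B: "B = P * A * Q" using B by (simp add: inv)
  have "Q * B = Q * (P * (A * Q))"
    by (subst B) (simp add: assoc_mult_mat[OF P A Q])
  also have "\<dots> = Q * P * (A * Q)"
    by (rule assoc_mult_mat[symmetric, OF Q P mult_carrier_mat[OF A Q]])
  also have "\<dots> = A * Q" using A Q by (simp add: inv)
  finally show "Q * B = A * Q" .
qed

lemma rep_iso_sym:
  assumes V: "is_rep K V" and W: "is_rep K W" and iso: "rep_iso K V W"
  shows "rep_iso K W V"
proof -
  obtain P Q where d: "fst W = fst V" and PQ: "mutual_inverse (fst V) P Q"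
    and eq: "\<And>g. g \<in> carrier K \<Longrightarrow> P * snd V g = snd W g * P"
    using iso by (rule rep_isoE) auto
  have "Q * snd W g = snd V g * Q" if g: "g \<in> carrier K" for g
    using intertwine_inverse(2)[OF PQ _ _ eq[OF g]] is_rep_carrier[OF V g] is_rep_carrier[OF W g] d
    by simp
  then show ?thesis
    using d PQ by (intro rep_isoI[of _ _ Q P]) (auto simp: mutual_inverse_sym)
qed

lemma rep_iso_trans:
  assumes V: "is_rep K V" and W: "is_rep K W" and U: "is_rep K U"
    and VW: "rep_iso K V W" and WU: "rep_iso K W U"
  shows "rep_iso K V U"
proof -
  obtain P Q where 1: "fst W = fst V" "mutual_inverse (fst V) P Q"
    "\<And>g. g \<in> carrier K \<Longrightarrow> P * snd V g = snd W g * P"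
    using VW by (rule rep_isoE) auto
  obtain R S where 2: "fst U = fst W" "mutual_inverse (fst W) R S"
    "\<And>g. g \<in> carrier K \<Longrightarrow> R * snd W g = snd U g * R"
    using WU by (rule rep_isoE) auto
  define n where "n = fst V"
  have "(R * P) * snd V g = snd U g * (R * P)" if g: "g \<in> carrier K" for g
  proof -
    have c: "P \<in> carrier_mat n n" "R \<in> carrier_mat n n" "snd V g \<in> carrier_mat n n"
      "snd W g \<in> carrier_mat n n" "snd U g \<in> carrier_mat n n"
      using 1 2 is_rep_carrier[OF V g] is_rep_carrier[OF W g] is_rep_carrier[OF U g]
      by (auto simp: mutual_inverse_def n_def)
    have "(R * P) * snd V g = R * (snd W g * P)"
      using c 1(3)[OF g] by (simp add: assoc_mult_mat[of _ n n _ n _ n])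
    also have "\<dots> = (R * snd W g) * P"
      using c by (simp add: assoc_mult_mat[of _ n n _ n _ n])
    also have "\<dots> = snd U g * (R * P)"
      using c 2(3)[OF g] by (simp add: assoc_mult_mat[of _ n n _ n _ n])
    finally show ?thesis .
  qed
  then show ?thesis
    using 1 2 mutual_inverse_mult[of "fst V" R S P Q] by (intro rep_isoI[of _ _ "R * P" "Q * S"]) auto
qed

lemma rep_iso_character:
  assumes V: "is_rep K V" and W: "is_rep K W" and iso: "rep_iso K V W" and g: "g \<in> carrier K"
  shows "character V g = character W g"
proof -
  obtain P Q where d: "fst W = fst V" and PQ: "mutual_inverse (fst V) P Q"
    and eq: "P * snd V g = snd W g * P"
    using iso g by (metis rep_isoE)
  define n where "n = fst V"
  have c: "P \<in> carrier_mat n n" "Q \<in> carrier_mat n n" "snd V g \<in> carrier_mat n n" "snd W g \<in> carrier_mat n n"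
    and inv: "Q * P = 1\<^sub>m n"
    using PQ is_rep_carrier[OF V g] is_rep_carrier[OF W g] d by (auto simp: mutual_inverse_def n_def)
  have "snd W g = P * snd V g * Q"
    using PQ c eq by (intro intertwine_inverse(1)[of n]) (simp_all add: n_def)
  then have "character W g = mat_trace ((P * snd V g) * Q)" by (simp add: character_def)
  also have "\<dots> = mat_trace (Q * (P * snd V g))" using c by (intro mat_trace_mult_commute[of _ n n]) auto
  also have "Q * (P * snd V g) = snd V g"
    using c inv by (simp flip: assoc_mult_mat[OF c(2,1,3)])
  finally show ?thesis by (simp add: character_def)
qed

lemma is_rep_conj:
  assumes V: "is_rep K V" and K: "monoid K" and PQ: "mutual_inverse (fst V) P Q"
  defines "W \<equiv> (fst V, \<lambda>g. P * snd V g * Q)"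
  shows "is_rep K W" "rep_iso K V W"
proof -
  interpret monoid K by fact
  define n where "n = fst V"
  have c: "P \<in> carrier_mat n n" "Q \<in> carrier_mat n n"
    and inv: "P * Q = 1\<^sub>m n" "Q * P = 1\<^sub>m n"
    using PQ by (auto simp: mutual_inverse_def n_def)
  have cV: "snd V g \<in> carrier_mat n n" if "g \<in> carrier K" for g
    using is_rep_carrier[OF V that] by (simp add: n_def)
  have mult: "P * snd V (g \<otimes>\<^bsub>K\<^esub> h) * Q = (P * snd V g * Q) * (P * snd V h * Q)"
    if gh: "g \<in> carrier K" "h \<in> carrier K" for g h
  proof -
    have "(P * snd V g * Q) * (P * snd V h * Q) = P * snd V g * (Q * P) * snd V h * Q"
      using c cV[OF gh(1)] cV[OF gh(2)] by (simp add: assoc_mult_mat[of _ n n _ n _ n] del: inv)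
    also have "\<dots> = P * (snd V g * snd V h) * Q"
      using c cV[OF gh(1)] cV[OF gh(2)] by (simp add: inv assoc_mult_mat[of _ n n _ n _ n])
    finally show ?thesis using is_rep_mult[OF V gh] by simp
  qed
  show "is_rep K W"
    unfolding is_rep_def W_def
  proof (intro conjI ballI)
    fix g assume "g \<in> carrier K"
    show "snd (fst V, \<lambda>g. P * snd V g * Q) g \<in>
        carrier_mat (fst (fst V, \<lambda>g. P * snd V g * Q)) (fst (fst V, \<lambda>g. P * snd V g * Q))"
      using c cV[OF \<open>g \<in> carrier K\<close>] by (simp add: n_def[symmetric])
  qed (use c inv mult is_rep_one[OF V] in \<open>simp_all add: n_def[symmetric]\<close>)
  show "rep_iso K V W"
  proof (rule rep_isoI[OF _ PQ])
    fix g assume g: "g \<in> carrier K"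
    have "P * snd V g * Q * P = P * snd V g * (Q * P)"
      using c cV[OF g] by (simp add: assoc_mult_mat[of _ n n _ n _ n])
    then show "P * snd V g = snd W g * P"
      using c cV[OF g] inv by (simp add: W_def)
  qed (simp add: W_def)
qed

lemma rep_sum_simps:
  "fst (rep_sum V W) = fst V + fst W"
  "snd (rep_sum V W) g =
     four_block_mat (snd V g) (0\<^sub>m (fst V) (fst W)) (0\<^sub>m (fst W) (fst V)) (snd W g)"
  by (simp_all add: rep_sum_def)

lemma is_rep_sum:
  assumes V: "is_rep K V" and W: "is_rep K W"
  shows "is_rep K (rep_sum V W)"
  unfolding is_rep_def
proof (intro conjI ballI)
  fix g h assume gh: "g \<in> carrier K" "h \<in> carrier K"
  note cs = is_rep_carrier[OF V gh(1)] is_rep_carrier[OF V gh(2)]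
    is_rep_carrier[OF W gh(1)] is_rep_carrier[OF W gh(2)]
  show "snd (rep_sum V W) (g \<otimes>\<^bsub>K\<^esub> h) = snd (rep_sum V W) g * snd (rep_sum V W) h"
    using cs by (simp add: rep_sum_simps is_rep_mult[OF V gh] is_rep_mult[OF W gh]
        mult_four_block_mat[of _ "fst V" "fst V" _ "fst W" _ "fst W" _ _ "fst V" _ "fst W"])
qed (auto simp: rep_sum_simps is_rep_carrier[OF V] is_rep_carrier[OF W] is_rep_one[OF V] is_rep_one[OF W])

lemma character_sum:
  assumes "is_rep K V" "is_rep K W" "g \<in> carrier K"
  shows "character (rep_sum V W) g = character V g + character W g"
  using is_rep_carrier[OF assms(1,3)] is_rep_carrier[OF assms(2,3)]
  by (simp add: character_def rep_sum_simps mat_trace_four_block)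

text \<open>The last \<open>s\<close> coordinates span a subrepresentation \<open>d\<close> with
  quotient \<open>a\<close>. Comparing corner blocks in the multiplication law gives the cocycle
  identity for \<open>c\<close> on which Maschke's theorem rests.\<close>

lemma is_rep_lower_block:
  assumes V: "is_rep K (r + s, \<lambda>g. four_block_mat (a g) (0\<^sub>m r s) (c g) (d g))" and K: "monoid K"
    and a: "\<And>g. a g \<in> carrier_mat r r" and c: "\<And>g. c g \<in> carrier_mat s r" and d: "\<And>g. d g \<in> carrier_mat s s"
  shows "is_rep K (r, a)" "is_rep K (s, d)"
    "\<And>g h. g \<in> carrier K \<Longrightarrow> h \<in> carrier K \<Longrightarrow> c (g \<otimes>\<^bsub>K\<^esub> h) = c g * a h + d g * c h"
proof -
  have 1: "a (g \<otimes>\<^bsub>K\<^esub> h) = a g * a h \<and> c (g \<otimes>\<^bsub>K\<^esub> h) = c g * a h + d g * c h \<and> d (g \<otimes>\<^bsub>K\<^esub> h) = d g * d h"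
    if "g \<in> carrier K" "h \<in> carrier K" for g h
  proof -
    have "four_block_mat (a (g \<otimes>\<^bsub>K\<^esub> h)) (0\<^sub>m r s) (c (g \<otimes>\<^bsub>K\<^esub> h)) (d (g \<otimes>\<^bsub>K\<^esub> h)) =
        four_block_mat (a g * a h) (0\<^sub>m r s) (c g * a h + d g * c h) (d g * d h)"
      using is_rep_mult[OF V that] a[of g] a[of h] c[of g] c[of h] d[of g] d[of h]
      by (simp add: mult_four_block_mat[of _ r r _ s _ s _ _ r _ s])
    then show ?thesis
      using a[of g] a[of h] c[of g] c[of h] d[of g] d[of h]
        a[of "g \<otimes>\<^bsub>K\<^esub> h"] c[of "g \<otimes>\<^bsub>K\<^esub> h"] d[of "g \<otimes>\<^bsub>K\<^esub> h"]
      by (subst (asm) four_block_mat_eq_iff[of _ r r _ s _ s]) auto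
  qed
  have "four_block_mat (a \<one>\<^bsub>K\<^esub>) (0\<^sub>m r s) (c \<one>\<^bsub>K\<^esub>) (d \<one>\<^bsub>K\<^esub>) =
      four_block_mat (1\<^sub>m r) (0\<^sub>m r s) (0\<^sub>m s r) (1\<^sub>m s)"
    using is_rep_one[OF V] by simp
  then have "a \<one>\<^bsub>K\<^esub> = 1\<^sub>m r \<and> d \<one>\<^bsub>K\<^esub> = 1\<^sub>m s"
    by (subst (asm) four_block_mat_eq_iff[of _ r r _ s _ s]) (auto simp: a c d)
  with 1 a d show "is_rep K (r, a)" "is_rep K (s, d)" by (auto simp: is_rep_def)
  show "c (g \<otimes>\<^bsub>K\<^esub> h) = c g * a h + d g * c h" if "g \<in> carrier K" "h \<in> carrier K" for g h
    using 1[OF that] by simp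
qed

lemma bij_betw_left_mult:
  assumes "group K" "h \<in> carrier K"
  shows "bij_betw (\<lambda>g. h \<otimes>\<^bsub>K\<^esub> g) (carrier K) (carrier K)"
proof -
  interpret group K by fact
  show ?thesis
    using assms(2) by (intro bij_betwI[of _ _ _ "\<lambda>g. inv\<^bsub>K\<^esub> h \<otimes>\<^bsub>K\<^esub> g"]) (auto simp: m_assoc[symmetric])
qed

text \<open>The corner \<open>c\<close> is a cocycle, and averaging over the finite group writes it
  as a coboundary \<open>d g * X - X * a g\<close>. The shear with corner \<open>X\<close> then
  conjugates the triangular representation into the direct sum.\<close>

lemma maschke_lower_block:
  assumes V: "is_rep K (r + s, \<lambda>g. four_block_mat (a g) (0\<^sub>m r s) (c g) (d g))" (is "is_rep K ?V")
    and K: "group K" and fin: "finite (carrier K)"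
    and a: "\<And>g. a g \<in> carrier_mat r r" and c: "\<And>g. c g \<in> carrier_mat s r" and d: "\<And>g. d g \<in> carrier_mat s s"
  shows "rep_iso K ?V (rep_sum (r, a) (s, d))"
proof -
  interpret group K by fact
  note blocks = is_rep_lower_block[OF V is_monoid a c d]
  define N where "N = card (carrier K)"
  have N: "N \<noteq> 0" using fin by (auto simp: N_def)
  \<comment> \<open>The average of the cocycle before dividing by \<open>N\<close>; after the
    scaling by \<open>k\<close> below, its coboundary is \<open>c\<close>.\<close>
  define T where "T = sum_mat s r (\<lambda>g. c g * a (inv\<^bsub>K\<^esub> g)) (carrier K)"
  have T: "T \<in> carrier_mat s r" by (simp add: T_def)
  have eq: "T * a h = of_nat N \<cdot>\<^sub>m c h + d h * T" if h: "h \<in> carrier K" for h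
  proof -
    have "T * a h = sum_mat s r (\<lambda>g. c g * a (inv\<^bsub>K\<^esub> g) * a h) (carrier K)"
      unfolding T_def using a c by (intro sum_mat_mult) (auto intro: mult_carrier_mat[OF c a])
    also have "\<dots> = sum_mat s r (\<lambda>g. c g * a (inv\<^bsub>K\<^esub> g \<otimes>\<^bsub>K\<^esub> h)) (carrier K)"
      using is_rep_mult[OF blocks(1)] h a c
      by (intro sum_mat_cong) (auto simp: assoc_mult_mat[of _ s r _ r _ r])
    \<comment> \<open>Substituting \<open>h g\<close> for \<open>g\<close> cancels the trailing
      \<open>h\<close> and exposes \<open>c\<close> of a product, to which the cocycle identity
      applies.\<close>
    also have "\<dots> = sum_mat s r (\<lambda>g. c (h \<otimes>\<^bsub>K\<^esub> g) * a (inv\<^bsub>K\<^esub> (h \<otimes>\<^bsub>K\<^esub> g) \<otimes>\<^bsub>K\<^esub> h)) (carrier K)"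
      by (rule sum_mat_reindex[symmetric]) (rule bij_betw_left_mult[OF K h])
    also have "\<dots> = sum_mat s r (\<lambda>g. c h + d h * (c g * a (inv\<^bsub>K\<^esub> g))) (carrier K)"
    proof (rule sum_mat_cong)
      fix g assume g: "g \<in> carrier K"
      have 1: "inv\<^bsub>K\<^esub> (h \<otimes>\<^bsub>K\<^esub> g) \<otimes>\<^bsub>K\<^esub> h = inv\<^bsub>K\<^esub> g"
        using g h by (simp add: inv_mult_group m_assoc)
      have 2: "a g * a (inv\<^bsub>K\<^esub> g) = 1\<^sub>m r"
        using is_rep_mult[OF blocks(1) g inv_closed[OF g]] is_rep_one[OF blocks(1)] g by simp
      have "c (h \<otimes>\<^bsub>K\<^esub> g) * a (inv\<^bsub>K\<^esub> g) = c h * (a g * a (inv\<^bsub>K\<^esub> g)) + d h * (c g * a (inv\<^bsub>K\<^esub> g))"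
        using blocks(3)[OF h g] a[of g] a[of "inv\<^bsub>K\<^esub> g"] c[of g] c[of h] d[of h]
        by (simp add: add_mult_distrib_mat[of _ s r _ _ r] assoc_mult_mat[of _ s r _ r _ r]
            assoc_mult_mat[of _ s s _ r _ r])
      then show "c (h \<otimes>\<^bsub>K\<^esub> g) * a (inv\<^bsub>K\<^esub> (h \<otimes>\<^bsub>K\<^esub> g) \<otimes>\<^bsub>K\<^esub> h) = c h + d h * (c g * a (inv\<^bsub>K\<^esub> g))"
        using c[of h] by (simp add: 1 2)
    qed
    also have "\<dots> = sum_mat s r (\<lambda>_. c h) (carrier K) + sum_mat s r (\<lambda>g. d h * (c g * a (inv\<^bsub>K\<^esub> g))) (carrier K)"
      using a c d by (intro sum_mat_add) (auto intro: mult_carrier_mat[OF d mult_carrier_mat[OF c a]])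
    also have "\<dots> = of_nat N \<cdot>\<^sub>m c h + d h * T"
      unfolding T_def N_def using a c d
      by (simp add: sum_mat_const[OF c] mult_sum_mat[of _ s s] mult_carrier_mat[of _ s r])
    finally show ?thesis .
  qed
  \<comment> \<open>The sign makes the lower left blocks of the intertwining relation agree, namely
    \<open>X * a g + c g = d g * X\<close>.\<close>
  define k where "k = - 1 / (of_nat N :: complex)"
  define X where "X = k \<cdot>\<^sub>m T"
  have X: "X \<in> carrier_mat s r" using T by (simp add: X_def)
  have Xeq: "X * a g + c g = d g * X" if g: "g \<in> carrier K" for g
  proof -
    have "X * a g = k \<cdot>\<^sub>m (of_nat N \<cdot>\<^sub>m c g + d g * T)"
      unfolding X_def eq[OF g, symmetric] by (rule mult_smult_assoc_mat[OF T a])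
    moreover have "d g * X = k \<cdot>\<^sub>m (d g * T)"
      unfolding X_def by (rule mult_smult_distrib[OF d T])
    moreover have "k \<cdot>\<^sub>m (of_nat N \<cdot>\<^sub>m c g + D) + c g = k \<cdot>\<^sub>m D" if "D \<in> carrier_mat s r" for D
      using that c[of g] N by (intro eq_matI) (auto simp: k_def field_simps)
    ultimately show ?thesis using T d by (simp add: mult_carrier_mat[of _ s s])
  qed
  show ?thesis
  proof (rule rep_isoI)
    show "mutual_inverse (fst ?V) (four_block_mat (1\<^sub>m r) (0\<^sub>m r s) X (1\<^sub>m s))
        (four_block_mat (1\<^sub>m r) (0\<^sub>m r s) (- X) (1\<^sub>m s))"
      using mutual_inverse_shear[OF X] by simp
    fix g assume g: "g \<in> carrier K"
    show "four_block_mat (1\<^sub>m r) (0\<^sub>m r s) X (1\<^sub>m s) * snd ?V g =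
        snd (rep_sum (r, a) (s, d)) g * four_block_mat (1\<^sub>m r) (0\<^sub>m r s) X (1\<^sub>m s)"
      using X a[of g] c[of g] d[of g] Xeq[OF g]
      by (simp add: rep_sum_simps mult_four_block_mat[of _ r r _ s _ s _ _ r _ s] mult_carrier_mat[of _ s s])
  qed (simp add: rep_sum_simps)
qed

section \<open>Characters and intertwiners\<close>

lemma is_rep_cong:
  assumes "monoid K" "fst V = fst W" "\<And>g. g \<in> carrier K \<Longrightarrow> snd V g = snd W g"
  shows "is_rep K V \<longleftrightarrow> is_rep K W"
  using assms by (auto simp: is_rep_def monoid.m_closed monoid.one_closed)

lemma rep_iso_cong:
  assumes "is_rep K V" "fst V = fst W" "\<And>g. g \<in> carrier K \<Longrightarrow> snd V g = snd W g"
  shows "rep_iso K V W"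
proof (rule rep_isoI[OF assms(2) mutual_inverse_one])
  fix g assume g: "g \<in> carrier K"
  show "1\<^sub>m (fst V) * snd V g = snd W g * 1\<^sub>m (fst V)"
    using is_rep_carrier[OF assms(1) g] assms(3)[OF g] by simp
qed

text \<open>Matrices assembled from blocks come with known sizes but without a multiplication law;
  conjugacy to a known representation supplies the law.\<close>

lemma is_rep_iso:
  assumes V: "is_rep K V" and K: "monoid K" and iso: "rep_iso K V W"
    and W: "\<And>g. g \<in> carrier K \<Longrightarrow> snd W g \<in> carrier_mat (fst W) (fst W)"
  shows "is_rep K W"
proof -
  obtain P Q where d: "fst W = fst V" and PQ: "mutual_inverse (fst V) P Q"
    and eq: "\<And>g. g \<in> carrier K \<Longrightarrow> P * snd V g = snd W g * P"
    using iso by (rule rep_isoE) auto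
  have "snd W g = P * snd V g * Q" if g: "g \<in> carrier K" for g
    using intertwine_inverse(1)[OF PQ is_rep_carrier[OF V g] _ eq[OF g]] W[OF g] d by simp
  then have "is_rep K W \<longleftrightarrow> is_rep K (fst V, \<lambda>g. P * snd V g * Q)"
    using d by (intro is_rep_cong[OF K]) auto
  then show ?thesis using is_rep_conj(1)[OF V K PQ] by simp
qed

text \<open>Exchanges two groups of coordinates while applying \<open>P\<close> to one of them; it
  is the base change behind the reorderings of summands below.\<close>

lemma mutual_inverse_antidiag:
  fixes P :: "'a::field mat"
  assumes "mutual_inverse s P Q"
  shows "mutual_inverse (s + r) (four_block_mat (0\<^sub>m s r) P (1\<^sub>m r) (0\<^sub>m r s))
           (four_block_mat (0\<^sub>m r s) (1\<^sub>m r) Q (0\<^sub>m s r))"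
proof -
  have P: "P \<in> carrier_mat s s" "Q \<in> carrier_mat s s" "P * Q = 1\<^sub>m s"
    using assms by (auto simp: mutual_inverse_def)
  have "four_block_mat (0\<^sub>m s r) P (1\<^sub>m r) (0\<^sub>m r s) * four_block_mat (0\<^sub>m r s) (1\<^sub>m r) Q (0\<^sub>m s r) =
      1\<^sub>m (s + r)"
    using P by (subst mult_four_block_mat[of _ s r _ s _ r _ _ s _ r]) auto
  moreover have "four_block_mat (0\<^sub>m s r) P (1\<^sub>m r) (0\<^sub>m r s) \<in> carrier_mat (s + r) (s + r)"
    "four_block_mat (0\<^sub>m r s) (1\<^sub>m r) Q (0\<^sub>m s r) \<in> carrier_mat (s + r) (s + r)"
    by (simp_all add: carrier_matI)
  ultimately show ?thesis by (intro mutual_inverseI) auto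
qed

section \<open>Conjugate transposes, the invariant form and characters at inverses\<close>

definition conj_transpose :: "complex mat \<Rightarrow> complex mat" where
  "conj_transpose A = mat (dim_col A) (dim_row A) (\<lambda>(i, j). cnj (A $$ (j, i)))"

lemma conj_transpose_carrier: "A \<in> carrier_mat n m \<Longrightarrow> conj_transpose A \<in> carrier_mat m n"
  by (auto simp: conj_transpose_def)

lemma conj_transpose_mult:
  assumes A: "A \<in> carrier_mat n k" and B: "B \<in> carrier_mat k m"
  shows "conj_transpose (A * B) = conj_transpose B * conj_transpose A"
proof (rule eq_matI)
  fix i j assume "i < dim_row (conj_transpose B * conj_transpose A)"
    "j < dim_col (conj_transpose B * conj_transpose A)"
  then have ij: "i < m" "j < n" using A B by (auto simp: conj_transpose_def)
  have "conj_transpose (A * B) $$ (i, j) = cnj ((A * B) $$ (j, i))"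
    using A B ij by (simp add: conj_transpose_def)
  also have "\<dots> = (\<Sum>l<k. cnj (A $$ (j, l)) * cnj (B $$ (l, i)))"
    by (simp add: index_mult_mat_sum[OF A B ij(2,1)] del: index_mult_mat(1))
  also have "\<dots> = (\<Sum>l<k. conj_transpose B $$ (i, l) * conj_transpose A $$ (l, j))"
    using A B ij by (intro sum.cong refl) (auto simp: conj_transpose_def mult.commute)
  also have "\<dots> = (conj_transpose B * conj_transpose A) $$ (i, j)"
    by (rule index_mult_mat_sum[symmetric, OF conj_transpose_carrier[OF B] conj_transpose_carrier[OF A] ij])
  finally show "conj_transpose (A * B) $$ (i, j) = (conj_transpose B * conj_transpose A) $$ (i, j)" .
qed (use A B in \<open>auto simp: conj_transpose_def\<close>)

lemma mat_trace_conj_transpose: "A \<in> carrier_mat n n \<Longrightarrow> mat_trace (conj_transpose A) = cnj (mat_trace A)"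
  by (simp add: mat_trace_def conj_transpose_def)

text \<open>The form \<open>\<Sum>\<^sub>g \<rho>(g)\<^sup>*\<rho>(g)\<close> is positive definite and invariant, so it conjugates
  \<open>\<rho>(g\<^sup>-\<^sup>1)\<close> into \<open>\<rho>(g)\<^sup>*\<close>.\<close>

lemma character_inv:
  assumes V: "is_rep K V" and K: "group K" and fin: "finite (carrier K)" and h: "h \<in> carrier K"
  shows "character V (inv\<^bsub>K\<^esub> h) = cnj (character V h)"
proof -
  interpret group K by fact
  define n where "n = fst V"
  define v where "v = snd V"
  have c: "v g \<in> carrier_mat n n" if "g \<in> carrier K" for g
    using is_rep_carrier[OF V that] by (simp add: v_def n_def)
  note c' = conj_transpose_carrier[OF c]
  have mult: "v (g \<otimes>\<^bsub>K\<^esub> g') = v g * v g'" if "g \<in> carrier K" "g' \<in> carrier K" for g g'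
    using is_rep_mult[OF V that] by (simp add: v_def)
  define F where "F = (\<lambda>g. conj_transpose (v g) * v g)"
  have F: "F g \<in> carrier_mat n n" if "g \<in> carrier K" for g
    unfolding F_def using c[OF that] c'[OF that] by simp
  define P where "P = sum_mat n n F (carrier K)"
  have P: "P \<in> carrier_mat n n" by (simp add: P_def)
  \<comment> \<open>If \<open>P\<close> kills \<open>w\<close>, then the value of the form at
    \<open>w\<close>, which is the sum of the squared lengths of all \<open>v g w\<close>, is 0; the
    term at the identity forces \<open>w = 0\<close>.\<close>
  have "det P \<noteq> 0"
  proof
    assume "det P = 0"
    then obtain w where w: "w \<in> carrier_vec n" "w \<noteq> 0\<^sub>v n" "P *\<^sub>v w = 0\<^sub>v n"
      using det_0_iff_vec_prod_zero[OF P] by blast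
    \<comment> \<open>The vector \<open>w\<close> as a one-column matrix, so that the rules for
      \<open>sum_mat\<close> apply to it.\<close>
    define x where "x = mat n 1 (\<lambda>(i, j). w $ i)"
    have x: "x \<in> carrier_mat n 1" and x': "conj_transpose x \<in> carrier_mat 1 n"
      by (simp_all add: x_def conj_transpose_def)
    have "P * x = 0\<^sub>m n 1"
    proof (rule eq_matI)
      fix i j assume "i < dim_row (0\<^sub>m n 1 :: complex mat)" "j < dim_col (0\<^sub>m n 1 :: complex mat)"
      then have ij: "i < n" "j = 0" by auto
      have "col x 0 = w" using w(1) by (intro eq_vecI) (auto simp: x_def)
      then have "(P * x) $$ (i, j) = (P *\<^sub>v w) $ i" using ij P x by simp
      then show "(P * x) $$ (i, j) = 0\<^sub>m n 1 $$ (i, j)" using w(3) ij by simp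
    qed (use P x in auto)
    then have "conj_transpose x * (P * x) = 0\<^sub>m 1 1" using x' by simp
    moreover have "conj_transpose x * (P * x) = sum_mat 1 1 (\<lambda>g. conj_transpose (v g * x) * (v g * x)) (carrier K)"
    proof -
      have Px: "P * x = sum_mat n 1 (\<lambda>g. F g * x) (carrier K)"
        unfolding P_def by (rule sum_mat_mult[OF x]) (rule F)
      have "conj_transpose x * (P * x) = sum_mat 1 1 (\<lambda>g. conj_transpose x * (F g * x)) (carrier K)"
        unfolding Px by (rule mult_sum_mat[OF x']) (rule mult_carrier_mat[OF F x])
      also have "\<dots> = sum_mat 1 1 (\<lambda>g. conj_transpose (v g * x) * (v g * x)) (carrier K)"
      proof (rule sum_mat_cong)
        fix g assume g: "g \<in> carrier K"
        have "conj_transpose (v g * x) * (v g * x) = conj_transpose x * conj_transpose (v g) * (v g * x)"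
          by (simp only: conj_transpose_mult[OF c[OF g] x])
        also have "\<dots> = conj_transpose x * (conj_transpose (v g) * (v g * x))"
          by (rule assoc_mult_mat[OF x' c'[OF g] mult_carrier_mat[OF c[OF g] x]])
        also have "\<dots> = conj_transpose x * (F g * x)"
          unfolding F_def by (simp only: assoc_mult_mat[OF c'[OF g] c[OF g] x])
        finally show "conj_transpose x * (F g * x) = conj_transpose (v g * x) * (v g * x)" ..
      qed
      finally show ?thesis .
    qed
    ultimately have "sum_mat 1 1 (\<lambda>g. conj_transpose (v g * x) * (v g * x)) (carrier K) $$ (0, 0) = 0"
      by simp
    then have "(\<Sum>g\<in>carrier K. (conj_transpose (v g * x) * (v g * x)) $$ (0, 0)) = 0"
      by (simp add: sum_mat_def)
    moreover have "(conj_transpose (v g * x) * (v g * x)) $$ (0, 0) =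
        complex_of_real (\<Sum>k<n. (norm ((v g * x) $$ (k, 0)))\<^sup>2)" if g: "g \<in> carrier K" for g
    proof -
      have sq: "conj_transpose y $$ (0, k) * y $$ (k, 0) = complex_of_real ((norm (y $$ (k, 0)))\<^sup>2)"
        if "y \<in> carrier_mat n 1" "k < n" for y k
        using that by (simp add: conj_transpose_def complex_norm_square mult.commute del: of_real_power)
      have y: "v g * x \<in> carrier_mat n 1" using c[OF g] x by simp
      have "(conj_transpose (v g * x) * (v g * x)) $$ (0, 0) =
          (\<Sum>k<n. conj_transpose (v g * x) $$ (0, k) * (v g * x) $$ (k, 0))"
        by (rule index_mult_mat_sum[OF conj_transpose_carrier[OF y] y]) auto
      also have "\<dots> = (\<Sum>k<n. complex_of_real ((norm ((v g * x) $$ (k, 0)))\<^sup>2))"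
        using sq[OF y] by (intro sum.cong refl) simp
      finally show ?thesis by simp
    qed
    ultimately have "complex_of_real (\<Sum>g\<in>carrier K. \<Sum>k<n. (norm ((v g * x) $$ (k, 0)))\<^sup>2) = 0"
      by simp
    then have "(\<Sum>g\<in>carrier K. \<Sum>k<n. (norm ((v g * x) $$ (k, 0)))\<^sup>2) = 0"
      by (simp only: of_real_eq_0_iff)
    then have "\<forall>g\<in>carrier K. (\<Sum>k<n. (norm ((v g * x) $$ (k, 0)))\<^sup>2) = 0"
      using fin by (subst (asm) sum_nonneg_eq_0_iff) (auto intro: sum_nonneg)
    then have "(\<Sum>k<n. (norm ((v \<one>\<^bsub>K\<^esub> * x) $$ (k, 0)))\<^sup>2) = 0" by blast
    moreover have "v \<one>\<^bsub>K\<^esub> * x = x" using is_rep_one[OF V] x by (simp add: v_def n_def)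
    ultimately have "x $$ (k, 0) = 0" if "k < n" for k
      using that by (subst (asm) sum_nonneg_eq_0_iff) auto
    then have "w = 0\<^sub>v n" using w(1) by (intro eq_vecI) (auto simp: x_def)
    with w(2) show False by simp
  qed
  from det_non_zero_imp_unit[OF P this, of "()"] obtain Q where "mutual_inverse n P Q"
    unfolding Units_def ring_mat_def mutual_inverse_def using P by auto
  note PQ = this
  have hi: "inv\<^bsub>K\<^esub> h \<in> carrier K" using h by simp
  have "P * v (inv\<^bsub>K\<^esub> h) = sum_mat n n (\<lambda>g. F g * v (inv\<^bsub>K\<^esub> h)) (carrier K)"
    unfolding P_def using F c[OF hi] by (intro sum_mat_mult) auto
  \<comment> \<open>Invariance of the form: replacing \<open>g\<close> by \<open>g h\<close> trades
    \<open>v (inv h)\<close> on the right for the conjugate transpose of \<open>v h\<close> on the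
    left.\<close>
  also have "\<dots> = sum_mat n n (\<lambda>g. F (g \<otimes>\<^bsub>K\<^esub> h) * v (inv\<^bsub>K\<^esub> h)) (carrier K)"
    by (rule sum_mat_reindex[symmetric], rule bij_betwI[of _ _ _ "\<lambda>g. g \<otimes>\<^bsub>K\<^esub> inv\<^bsub>K\<^esub> h"])
      (use h in \<open>auto simp: m_assoc\<close>)
  also have "\<dots> = sum_mat n n (\<lambda>g. conj_transpose (v h) * F g) (carrier K)"
  proof (rule sum_mat_cong)
    fix g assume g: "g \<in> carrier K"
    have gh: "g \<otimes>\<^bsub>K\<^esub> h \<in> carrier K" using g h by simp
    have "F (g \<otimes>\<^bsub>K\<^esub> h) * v (inv\<^bsub>K\<^esub> h) = conj_transpose (v (g \<otimes>\<^bsub>K\<^esub> h)) * (v (g \<otimes>\<^bsub>K\<^esub> h) * v (inv\<^bsub>K\<^esub> h))"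
      unfolding F_def by (rule assoc_mult_mat[OF c'[OF gh] c[OF gh] c[OF hi]])
    also have "v (g \<otimes>\<^bsub>K\<^esub> h) * v (inv\<^bsub>K\<^esub> h) = v g"
      using g h by (simp add: mult[symmetric] m_assoc)
    also have "conj_transpose (v (g \<otimes>\<^bsub>K\<^esub> h)) * v g = conj_transpose (v h) * F g"
      unfolding mult[OF g h] conj_transpose_mult[OF c[OF g] c[OF h]] F_def
      by (rule assoc_mult_mat[OF c'[OF h] c'[OF g] c[OF g]])
    finally show "F (g \<otimes>\<^bsub>K\<^esub> h) * v (inv\<^bsub>K\<^esub> h) = conj_transpose (v h) * F g" .
  qed
  also have "\<dots> = conj_transpose (v h) * P"
    unfolding P_def using F c'[OF h] by (intro mult_sum_mat[symmetric]) auto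
  finally have eq: "P * v (inv\<^bsub>K\<^esub> h) = conj_transpose (v h) * P" .
  \<comment> \<open>Similar matrices have equal traces; here they are \<open>v (inv h)\<close> and
    the conjugate transpose of \<open>v h\<close>.\<close>
  have "Q * (P * v (inv\<^bsub>K\<^esub> h)) = v (inv\<^bsub>K\<^esub> h)"
    using PQ c[OF hi] by (auto simp: mutual_inverse_def simp flip: assoc_mult_mat[of _ n n _ n _ n])
  moreover have "conj_transpose (v h) = P * v (inv\<^bsub>K\<^esub> h) * Q"
    by (rule intertwine_inverse(1)[OF PQ c[OF hi] c'[OF h] eq])
  moreover have "mat_trace (P * v (inv\<^bsub>K\<^esub> h) * Q) = mat_trace (Q * (P * v (inv\<^bsub>K\<^esub> h)))"
    using PQ P c[OF hi] by (intro mat_trace_mult_commute[of _ n n]) (auto simp: mutual_inverse_def)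
  ultimately have "mat_trace (conj_transpose (v h)) = mat_trace (v (inv\<^bsub>K\<^esub> h))" by simp
  then show ?thesis using mat_trace_conj_transpose[OF c[OF h]] by (simp add: character_def v_def)
qed

text \<open>Every matrix averages to an intertwiner. If all averages vanished, applying this to
  matrix units and summing over diagonal entries would give a zero sum of
  \<open>character W g * character V (inv g)\<close>, that is, of squared absolute values, although
  the identity contributes \<open>n\<close> squared.\<close>

lemma exists_nonzero_intertwiner:
  assumes V: "is_rep K V" and W: "is_rep K W" and K: "group K" and fin: "finite (carrier K)"
    and n: "fst V = n" "fst W = n" "n > 0"
    and eq: "\<And>g. g \<in> carrier K \<Longrightarrow> character V g = character W g"
  shows "\<exists>X \<in> carrier_mat n n. X \<noteq> 0\<^sub>m n n \<and> (\<forall>g\<in>carrier K. X * snd V g = snd W g * X)"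
proof (rule ccontr)
  assume none: "\<not> ?thesis"
  interpret group K by fact
  have c: "snd V g \<in> carrier_mat n n" "snd W g \<in> carrier_mat n n" if "g \<in> carrier K" for g
    using is_rep_carrier[OF V that] is_rep_carrier[OF W that] n by simp_all
  define av where "av X = sum_mat n n (\<lambda>g. snd W g * (X * snd V (inv\<^bsub>K\<^esub> g))) (carrier K)" for X
  have av: "av X \<in> carrier_mat n n" for X by (simp add: av_def)
  have av0: "av X = 0\<^sub>m n n" if X: "X \<in> carrier_mat n n" for X
  proof -
    have "av X * snd V h = snd W h * av X" if h: "h \<in> carrier K" for h
    proof -
      have "snd W h * av X = sum_mat n n (\<lambda>g. snd W h * (snd W g * (X * snd V (inv\<^bsub>K\<^esub> g)))) (carrier K)"
        unfolding av_def using c h X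
        by (intro mult_sum_mat) (auto intro!: mult_carrier_mat[of _ n n])
      also have "\<dots> = sum_mat n n (\<lambda>g. snd W (h \<otimes>\<^bsub>K\<^esub> g) * (X * snd V (inv\<^bsub>K\<^esub> (h \<otimes>\<^bsub>K\<^esub> g))) * snd V h) (carrier K)"
      proof (rule sum_mat_cong)
        fix g assume g: "g \<in> carrier K"
        have gi: "inv\<^bsub>K\<^esub> g \<in> carrier K" and hg: "inv\<^bsub>K\<^esub> (h \<otimes>\<^bsub>K\<^esub> g) \<in> carrier K" using g h by auto
        have V': "snd V (inv\<^bsub>K\<^esub> g) = snd V (inv\<^bsub>K\<^esub> (h \<otimes>\<^bsub>K\<^esub> g)) * snd V h"
          using g h by (simp add: is_rep_mult[OF V, symmetric] inv_mult_group m_assoc)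
        show "snd W h * (snd W g * (X * snd V (inv\<^bsub>K\<^esub> g))) =
            snd W (h \<otimes>\<^bsub>K\<^esub> g) * (X * snd V (inv\<^bsub>K\<^esub> (h \<otimes>\<^bsub>K\<^esub> g))) * snd V h"
          unfolding is_rep_mult[OF W h g] V' using c[OF g] c[OF h] c[OF hg] X
          by (simp add: assoc_mult_mat[of _ n n _ n _ n] mult_carrier_mat[of _ n n _ n])
      qed
      also have "\<dots> = sum_mat n n (\<lambda>g. snd W g * (X * snd V (inv\<^bsub>K\<^esub> g)) * snd V h) (carrier K)"
        by (rule sum_mat_reindex[OF bij_betw_left_mult[OF K h],
              where F = "\<lambda>g. snd W g * (X * snd V (inv\<^bsub>K\<^esub> g)) * snd V h"])
      also have "\<dots> = av X * snd V h"
        unfolding av_def using c h X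
        by (intro sum_mat_mult[symmetric]) (auto intro!: mult_carrier_mat[of _ n n])
      finally show ?thesis ..
    qed
    then show ?thesis using none av by blast
  qed
  have zero: "(\<Sum>g\<in>carrier K. snd W g $$ (i, i) * snd V (inv\<^bsub>K\<^esub> g) $$ (j, j)) = 0"
    if ij: "i < n" "j < n" for i j
  proof -
    \<comment> \<open>The matrix unit at \<open>(i, j)\<close>: the entry \<open>(i, j)\<close> of
      its average is a sum of products of one diagonal entry from each representation.\<close>
    define E where "E = mat n n (\<lambda>(a, b). if a = i \<and> b = j then 1 else (0::complex))"
    have E: "E \<in> carrier_mat n n" by (simp add: E_def)
    have "(snd W g * (E * snd V (inv\<^bsub>K\<^esub> g))) $$ (i, j) = snd W g $$ (i, i) * snd V (inv\<^bsub>K\<^esub> g) $$ (j, j)"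
      if g: "g \<in> carrier K" for g
    proof -
      have gi: "inv\<^bsub>K\<^esub> g \<in> carrier K" using g by simp
      have EV: "E * snd V (inv\<^bsub>K\<^esub> g) \<in> carrier_mat n n" using E c[OF gi] by simp
      have "(E * snd V (inv\<^bsub>K\<^esub> g)) $$ (l, j) = (if l = i then snd V (inv\<^bsub>K\<^esub> g) $$ (j, j) else 0)"
        if l: "l < n" for l
      proof -
        have "(E * snd V (inv\<^bsub>K\<^esub> g)) $$ (l, j) = (\<Sum>k<n. E $$ (l, k) * snd V (inv\<^bsub>K\<^esub> g) $$ (k, j))"
          by (rule index_mult_mat_sum[OF E c(1)[OF gi] l ij(2)])
        also have "\<dots> = (\<Sum>k<n. if k = j then (if l = i then snd V (inv\<^bsub>K\<^esub> g) $$ (j, j) else 0) else 0)"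
          using l by (intro sum.cong refl) (auto simp: E_def)
        also have "\<dots> = (if l = i then snd V (inv\<^bsub>K\<^esub> g) $$ (j, j) else 0)"
          using ij by (simp add: sum.delta)
        finally show ?thesis .
      qed
      then have "(snd W g * (E * snd V (inv\<^bsub>K\<^esub> g))) $$ (i, j) =
          (\<Sum>l<n. snd W g $$ (i, l) * (if l = i then snd V (inv\<^bsub>K\<^esub> g) $$ (j, j) else 0))"
        by (subst index_mult_mat_sum[OF c(2)[OF g] EV ij]) (auto intro!: sum.cong)
      also have "\<dots> = (\<Sum>l<n. if l = i then snd W g $$ (i, i) * snd V (inv\<^bsub>K\<^esub> g) $$ (j, j) else 0)"
        by (intro sum.cong refl) auto
      also have "\<dots> = snd W g $$ (i, i) * snd V (inv\<^bsub>K\<^esub> g) $$ (j, j)"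
        using ij by (simp add: sum.delta)
      finally show ?thesis .
    qed
    then have "av E $$ (i, j) = (\<Sum>g\<in>carrier K. snd W g $$ (i, i) * snd V (inv\<^bsub>K\<^esub> g) $$ (j, j))"
      using ij by (simp add: av_def sum_mat_def)
    then show ?thesis using av0[OF E] ij by simp
  qed
  have "(\<Sum>g\<in>carrier K. character W g * character V (inv\<^bsub>K\<^esub> g)) =
      (\<Sum>g\<in>carrier K. \<Sum>i<n. \<Sum>j<n. snd W g $$ (i, i) * snd V (inv\<^bsub>K\<^esub> g) $$ (j, j))"
    using c by (intro sum.cong refl) (simp add: character_def mat_trace_def sum_product carrier_matD[OF c(1)] carrier_matD[OF c(2)])
  also have "\<dots> = (\<Sum>i<n. \<Sum>j<n. \<Sum>g\<in>carrier K. snd W g $$ (i, i) * snd V (inv\<^bsub>K\<^esub> g) $$ (j, j))"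
    by (subst sum.swap, intro sum.cong refl, rule sum.swap)
  also have "\<dots> = 0" using zero by simp
  finally have "(\<Sum>g\<in>carrier K. character W g * character V (inv\<^bsub>K\<^esub> g)) = 0" .
  \<comment> \<open>Equality of the characters together with \<open>character_inv\<close> turns each
    product into a squared norm.\<close>
  moreover have "character W g * character V (inv\<^bsub>K\<^esub> g) = complex_of_real ((norm (character V g))\<^sup>2)"
    if "g \<in> carrier K" for g
    using that eq character_inv[OF V K fin] by (simp add: complex_norm_square del: of_real_power)
  ultimately have "complex_of_real (\<Sum>g\<in>carrier K. (norm (character V g))\<^sup>2) = 0" by simp
  then have "(\<Sum>g\<in>carrier K. (norm (character V g))\<^sup>2) = 0" by (simp only: of_real_eq_0_iff)
  then have "norm (character V \<one>\<^bsub>K\<^esub>) = 0"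
    using fin by (subst (asm) sum_nonneg_eq_0_iff) auto
  then show False using n by (simp add: character_one[OF V])
qed

section \<open>Characters determine representations\<close>

text \<open>Explicit formulas let the blocks be defined as functions of \<open>g\<close> with the
  right size for every \<open>g\<close>, as \<open>is_rep_lower_block\<close> and
  \<open>maschke_lower_block\<close> demand.\<close>

lemma four_block_mat_of_blocks:
  assumes "A \<in> carrier_mat (n1 + n2) (m1 + m2)"
  shows "A = four_block_mat (mat n1 m1 (\<lambda>ij. A $$ ij)) (mat n1 m2 (\<lambda>(i, j). A $$ (i, j + m1)))
      (mat n2 m1 (\<lambda>(i, j). A $$ (i + n1, j))) (mat n2 m2 (\<lambda>(i, j). A $$ (i + n1, j + m1)))"
  using assms by (intro eq_matI) auto

lemma partial_identity_zero: "partial_identity 0 s = 0\<^sub>m s s"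
  by (intro eq_matI) (auto simp: partial_identity_def)

text \<open>The swap fits the next theorem, where the common block is a quotient of one
  representation and a subrepresentation of the other, and so ends up in opposite positions of the
  two sums.\<close>

lemma rep_iso_sum_swap:
  assumes V: "is_rep K V" and V': "is_rep K V'" and W: "is_rep K W" and W': "is_rep K W'"
    and VV': "\<And>g. g \<in> carrier K \<Longrightarrow> snd V g = snd V' g" "fst V = fst V'" and WW': "rep_iso K W W'"
  shows "rep_iso K (rep_sum V W) (rep_sum W' V')"
proof -
  define r s where "r = fst V" and "s = fst W"
  obtain P Q where d: "fst W' = s" and PQ: "mutual_inverse s P Q"
    and eq: "\<And>g. g \<in> carrier K \<Longrightarrow> P * snd W g = snd W' g * P"
    using WW' unfolding s_def by (rule rep_isoE) auto
  have P: "P \<in> carrier_mat s s" using PQ by (auto simp: mutual_inverse_def)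
  show ?thesis
  proof (rule rep_isoI)
    show "fst (rep_sum V W) = fst (rep_sum W' V')"
      using d VV'(2) by (simp add: rep_sum_simps s_def)
    show "mutual_inverse (fst (rep_sum V W)) (four_block_mat (0\<^sub>m s r) P (1\<^sub>m r) (0\<^sub>m r s))
           (four_block_mat (0\<^sub>m r s) (1\<^sub>m r) Q (0\<^sub>m s r))"
      using mutual_inverse_antidiag[OF PQ, of r] by (simp add: rep_sum_simps r_def s_def add.commute)
    fix g assume g: "g \<in> carrier K"
    have c: "snd V' g \<in> carrier_mat r r" "snd W g \<in> carrier_mat s s" "snd W' g \<in> carrier_mat s s"
      using is_rep_carrier[OF V' g] is_rep_carrier[OF W g] is_rep_carrier[OF W' g] d VV'(2)
      by (auto simp: r_def s_def)
    have "four_block_mat (0\<^sub>m s r) P (1\<^sub>m r) (0\<^sub>m r s) * snd (rep_sum V W) g =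
        four_block_mat (0\<^sub>m s r) (P * snd W g) (snd V' g) (0\<^sub>m r s)"
      using c P by (simp add: rep_sum_simps VV'(1)[OF g] VV'(2) r_def[symmetric, unfolded VV'(2)] s_def[symmetric]
          mult_four_block_mat[of _ s r _ s _ r _ _ r _ s])
    also have "\<dots> = snd (rep_sum W' V') g * four_block_mat (0\<^sub>m s r) P (1\<^sub>m r) (0\<^sub>m r s)"
      using c P by (simp add: rep_sum_simps d eq[OF g] r_def[symmetric, unfolded VV'(2)]
          mult_four_block_mat[of _ s s _ r _ r _ _ r _ s])
    finally show "four_block_mat (0\<^sub>m s r) P (1\<^sub>m r) (0\<^sub>m r s) * snd (rep_sum V W) g =
        snd (rep_sum W' V') g * four_block_mat (0\<^sub>m s r) P (1\<^sub>m r) (0\<^sub>m r s)" .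
  qed
qed

text \<open>Strong induction on the degree. A nonzero intertwiner in rank normal form exhibits a
  common block of degree \<open>r > 0\<close>; Maschke's theorem splits it off on both sides, and
  the remaining blocks again have equal characters.\<close>

theorem character_eq_imp_rep_iso:
  assumes K: "group K" and fin: "finite (carrier K)"
    and "is_rep K V" "is_rep K W" "\<And>g. g \<in> carrier K \<Longrightarrow> character V g = character W g"
  shows "rep_iso K V W"
  using assms(3-)
proof (induction "fst V" arbitrary: V W rule: less_induct)
  case less
  interpret group K by fact
  note V = less.prems(1) and W = less.prems(2) and chi = less.prems(3)
  define n where "n = fst V"
  have "(of_nat (fst V) :: complex) = of_nat (fst W)"
    using chi[OF one_closed] character_one[OF V] character_one[OF W] by simp
  then have nW: "fst W = n" by (simp add: n_def)
  show ?case
  proof (cases "n = 0")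
    case True
    have "snd V g = snd W g" if "g \<in> carrier K" for g
      using is_rep_carrier[OF V that] is_rep_carrier[OF W that] True nW
      by (intro eq_matI) (auto simp: n_def)
    then show ?thesis using nW by (intro rep_iso_cong[OF V]) (auto simp: n_def)
  next
    case False
    then obtain X where X: "X \<in> carrier_mat n n" "X \<noteq> 0\<^sub>m n n"
      and XVW: "\<And>g. g \<in> carrier K \<Longrightarrow> X * snd V g = snd W g * X"
      using exists_nonzero_intertwiner[OF V W K fin n_def[symmetric] nW _ chi] by blast
    obtain r s P P' Q Q' where rs: "n = r + s" and PP: "mutual_inverse n P P'" and QQ: "mutual_inverse n Q Q'"
      and D: "partial_identity r s = P * X * Q"
      using rank_normal_form[OF X(1)] by (auto simp: mat_equiv_def)
    have cP: "P \<in> carrier_mat n n" "P' \<in> carrier_mat n n" "P' * P = 1\<^sub>m n"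
      and cQ: "Q \<in> carrier_mat n n" "Q' \<in> carrier_mat n n" "Q * Q' = 1\<^sub>m n"
      using PP QQ by (auto simp: mutual_inverse_def)
    \<comment> \<open>Positive rank is what makes the degree drop in the induction.\<close>
    have "r \<noteq> 0"
    proof
      assume "r = 0"
      then have "P * X * Q = 0\<^sub>m n n" using D rs by (simp flip: D add: partial_identity_zero)
      then have "P' * (P * X * Q) * Q' = 0\<^sub>m n n" using cP cQ by simp
      moreover have "P' * (P * X * Q) * Q' = (P' * P) * X * (Q * Q')"
        using cP(1,2) cQ(1,2) X by (simp add: assoc_mult_mat[of _ n n _ n _ n] mult_carrier_mat[of _ n n _ n])
      ultimately show False using cP cQ X by simp
    qed
    \<comment> \<open>The base changes in source and target that turn \<open>X\<close> into the
      partial identity.\<close>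
    define V1 where "V1 = (fst V, \<lambda>g. Q' * snd V g * Q)"
    define W1 where "W1 = (fst W, \<lambda>g. P * snd W g * P')"
    have V1: "is_rep K V1" "rep_iso K V V1"
      using is_rep_conj[OF V is_monoid, of Q' Q] mutual_inverse_sym[OF QQ] by (simp_all add: V1_def n_def)
    have W1: "is_rep K W1" "rep_iso K W W1"
      using is_rep_conj[OF W is_monoid, of P P'] PP by (simp_all add: W1_def nW)
    have cV1: "snd V1 g \<in> carrier_mat (r + s) (r + s)" and cW1: "snd W1 g \<in> carrier_mat (r + s) (r + s)"
      if "g \<in> carrier K" for g
      using is_rep_carrier[OF V1(1) that] is_rep_carrier[OF W1(1) that] rs nW
      by (simp_all add: V1_def W1_def n_def)
    have DVW: "partial_identity r s * snd V1 g = snd W1 g * partial_identity r s" if g: "g \<in> carrier K" for g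
    proof -
      have c: "snd V g \<in> carrier_mat n n" "snd W g \<in> carrier_mat n n"
        using is_rep_carrier[OF V g] is_rep_carrier[OF W g] nW by (auto simp: n_def)
      have "(P * X * Q) * (Q' * snd V g * Q) = P * X * (Q * Q') * snd V g * Q"
        using c cP(1,2) cQ(1,2) X by (simp add: assoc_mult_mat[of _ n n _ n _ n] mult_carrier_mat[of _ n n _ n])
      also have "\<dots> = P * (X * snd V g) * Q"
        using c cP(1) cQ X by (simp add: assoc_mult_mat[of _ n n _ n _ n] mult_carrier_mat[of _ n n _ n])
      also have "\<dots> = P * snd W g * (P' * P) * X * Q"
        unfolding XVW[OF g] using c cP cQ(1) X
        by (simp add: assoc_mult_mat[of _ n n _ n _ n] mult_carrier_mat[of _ n n _ n])
      also have "\<dots> = (P * snd W g * P') * (P * X * Q)"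
        using c cP(1,2) cQ(1,2) X by (simp add: assoc_mult_mat[of _ n n _ n _ n] mult_carrier_mat[of _ n n _ n])
      finally show ?thesis by (simp add: D V1_def W1_def)
    qed
    define a c d where "a g = mat r r (\<lambda>ij. snd V1 g $$ ij)"
      and "c g = mat s r (\<lambda>(i, j). snd V1 g $$ (i + r, j))"
      and "d g = mat s s (\<lambda>(i, j). snd V1 g $$ (i + r, j + r))" for g
    define a' b' d' where "a' g = mat r r (\<lambda>ij. snd W1 g $$ ij)"
      and "b' g = mat r s (\<lambda>(i, j). snd W1 g $$ (i, j + r))"
      and "d' g = mat s s (\<lambda>(i, j). snd W1 g $$ (i + r, j + r))" for g
    have ca: "a g \<in> carrier_mat r r" and cc: "c g \<in> carrier_mat s r" and cd: "d g \<in> carrier_mat s s"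
      and ca': "a' g \<in> carrier_mat r r" and cb': "b' g \<in> carrier_mat r s" and cd': "d' g \<in> carrier_mat s s" for g
      by (simp_all add: a_def c_def d_def a'_def b'_def d'_def)
    \<comment> \<open>Commuting with the partial identity kills the upper right block of
      \<open>V1\<close> and the lower left block of \<open>W1\<close>, and identifies their first
      diagonal blocks.\<close>
    have blocks: "snd V1 g = four_block_mat (a g) (0\<^sub>m r s) (c g) (d g) \<and>
        snd W1 g = four_block_mat (a' g) (b' g) (0\<^sub>m s r) (d' g) \<and> a g = a' g" if g: "g \<in> carrier K" for g
    proof -
      define b c' where "b = mat r s (\<lambda>(i, j). snd V1 g $$ (i, j + r))"
        and "c' = mat s r (\<lambda>(i, j). snd W1 g $$ (i + r, j))"
      have cb: "b \<in> carrier_mat r s" and cc': "c' \<in> carrier_mat s r"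
        by (simp_all add: b_def c'_def)
      have 1: "snd V1 g = four_block_mat (a g) b (c g) (d g)"
        unfolding a_def b_def c_def d_def by (rule four_block_mat_of_blocks[OF cV1[OF g]])
      have 2: "snd W1 g = four_block_mat (a' g) (b' g) c' (d' g)"
        unfolding a'_def b'_def c'_def d'_def by (rule four_block_mat_of_blocks[OF cW1[OF g]])
      have "partial_identity r s * snd V1 g = four_block_mat (a g) b (0\<^sub>m s r) (0\<^sub>m s s)"
        unfolding 1 partial_identity_def using ca[of g] cb cc[of g] cd[of g]
        by (simp add: mult_four_block_mat[of _ r r _ s _ s _ _ r _ s])
      moreover have "snd W1 g * partial_identity r s = four_block_mat (a' g) (0\<^sub>m r s) c' (0\<^sub>m s s)"
        unfolding 2 partial_identity_def using ca'[of g] cb'[of g] cc' cd'[of g]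
        by (simp add: mult_four_block_mat[of _ r r _ s _ s _ _ r _ s])
      ultimately have "four_block_mat (a g) b (0\<^sub>m s r) (0\<^sub>m s s) = four_block_mat (a' g) (0\<^sub>m r s) c' (0\<^sub>m s s)"
        using DVW[OF g] by simp
      then have "a g = a' g \<and> b = 0\<^sub>m r s \<and> 0\<^sub>m s r = c' \<and> 0\<^sub>m s s = (0\<^sub>m s s :: complex mat)"
        by (subst (asm) four_block_mat_eq_iff[OF ca cb zero_carrier_mat zero_carrier_mat ca' zero_carrier_mat cc'
              zero_carrier_mat])
      then show ?thesis using 1 2 by auto
    qed
    define V2 where "V2 = (r + s, \<lambda>g. four_block_mat (a g) (0\<^sub>m r s) (c g) (d g))"
    \<comment> \<open>Exchanging the two groups of coordinates makes the upper triangular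
      \<open>W1\<close> lower triangular, the shape that \<open>maschke_lower_block\<close>
      handles.\<close>
    define W2 where "W2 = (s + r, \<lambda>g. four_block_mat (d' g) (0\<^sub>m s r) (b' g) (a' g))"
    have V12: "rep_iso K V1 V2"
      using blocks rs by (intro rep_iso_cong[OF V1(1)]) (auto simp: V1_def V2_def n_def)
    then have V2: "is_rep K V2"
      using ca cc cd by (intro is_rep_iso[OF V1(1) is_monoid V12]) (auto simp: V2_def)
    have W12: "rep_iso K W1 W2"
    proof (rule rep_isoI)
      show "mutual_inverse (fst W1) (four_block_mat (0\<^sub>m s r) (1\<^sub>m s) (1\<^sub>m r) (0\<^sub>m r s) :: complex mat)
           (four_block_mat (0\<^sub>m r s) (1\<^sub>m r) (1\<^sub>m s) (0\<^sub>m s r))"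
        using mutual_inverse_antidiag[OF mutual_inverse_one, of s r] nW rs by (simp add: W1_def add.commute)
      fix g assume g: "g \<in> carrier K"
      have "four_block_mat (0\<^sub>m s r) (1\<^sub>m s) (1\<^sub>m r) (0\<^sub>m r s) * snd W1 g =
          four_block_mat (0\<^sub>m s r) (d' g) (a' g) (b' g)"
        using blocks[OF g] ca'[of g] cb'[of g] cd'[of g]
        by (simp add: mult_four_block_mat[of _ s r _ s _ r _ _ r _ s])
      also have "\<dots> = snd W2 g * four_block_mat (0\<^sub>m s r) (1\<^sub>m s) (1\<^sub>m r) (0\<^sub>m r s)"
        using ca'[of g] cb'[of g] cd'[of g]
        by (simp add: W2_def mult_four_block_mat[of _ s s _ r _ r _ _ r _ s])
      finally show "four_block_mat (0\<^sub>m s r) (1\<^sub>m s) (1\<^sub>m r) (0\<^sub>m r s) * snd W1 g =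
          snd W2 g * four_block_mat (0\<^sub>m s r) (1\<^sub>m s) (1\<^sub>m r) (0\<^sub>m r s)" .
    qed (use nW rs in \<open>simp add: W1_def W2_def\<close>)
    then have W2: "is_rep K W2"
      using ca' cb' cd' by (intro is_rep_iso[OF W1(1) is_monoid W12]) (auto simp: W2_def)
    note repV2 = is_rep_lower_block(1,2)[OF V2[unfolded V2_def] is_monoid ca cc cd]
    note repW2 = is_rep_lower_block(1,2)[OF W2[unfolded W2_def] is_monoid cd' cb' ca']
    have mV: "rep_iso K V2 (rep_sum (r, a) (s, d))"
      unfolding V2_def by (rule maschke_lower_block[OF V2[unfolded V2_def] K fin ca cc cd])
    have mW: "rep_iso K W2 (rep_sum (s, d') (r, a'))"
      unfolding W2_def by (rule maschke_lower_block[OF W2[unfolded W2_def] K fin cd' cb' ca'])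
    note sumV = is_rep_sum[OF repV2] and sumW = is_rep_sum[OF repW2]
    have isoV: "rep_iso K V (rep_sum (r, a) (s, d))"
      using rep_iso_trans[OF V V1(1) sumV V1(2) rep_iso_trans[OF V1(1) V2 sumV V12 mV]] .
    have isoW: "rep_iso K W (rep_sum (s, d') (r, a'))"
      using rep_iso_trans[OF W W1(1) sumW W1(2) rep_iso_trans[OF W1(1) W2 sumW W12 mW]] .
    have "rep_iso K (s, d) (s, d')"
    proof (rule less.hyps[OF _ repV2(2) repW2(1)])
      show "fst (s, d) < fst V" using \<open>r \<noteq> 0\<close> rs by (simp add: n_def)
      fix g assume g: "g \<in> carrier K"
      have "character (r, a) g + character (s, d) g = character (s, d') g + character (r, a') g"
        using rep_iso_character[OF V sumV isoV g] rep_iso_character[OF W sumW isoW g] chi[OF g]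
          character_sum[OF repV2 g] character_sum[OF repW2 g] by simp
      moreover have "character (r, a) g = character (r, a') g"
        using blocks[OF g] by (simp add: character_def)
      ultimately show "character (s, d) g = character (s, d') g" by simp
    qed
    then have "rep_iso K (rep_sum (r, a) (s, d)) (rep_sum (s, d') (r, a'))"
      using repV2 repW2 blocks by (intro rep_iso_sum_swap) auto
    then show ?thesis
      using rep_iso_trans[OF V sumW W _ rep_iso_sym[OF W sumW isoW]] rep_iso_trans[OF V sumV sumW isoV] by blast
  qed
qed

text \<open>The auxiliary summand \<open>U\<close> cancels in characters. Conversely, equal
  characters give an isomorphism outright, and \<open>U\<close> can be taken of degree 0. This turns
  equalities in the Grothendieck group into equalities of class functions.\<close>

lemma groth_eq_iff_character:
  assumes K: "group K" and fin: "finite (carrier K)"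
    and V: "is_rep K V" and W: "is_rep K W" and V': "is_rep K V'" and W': "is_rep K W'"
  shows "groth_eq K (V, W) (V', W') \<longleftrightarrow>
    (\<forall>g\<in>carrier K. character V g + character W' g = character V' g + character W g)"
proof
  assume "groth_eq K (V, W) (V', W')"
  then obtain U where U: "is_rep K U"
    and iso: "rep_iso K (rep_sum (rep_sum V W') U) (rep_sum (rep_sum V' W) U)"
    by (auto simp: groth_eq_def)
  show "\<forall>g\<in>carrier K. character V g + character W' g = character V' g + character W g"
  proof
    fix g assume g: "g \<in> carrier K"
    show "character V g + character W' g = character V' g + character W g"
      using rep_iso_character[OF _ _ iso g] assms U g by (simp add: character_sum[of K] is_rep_sum)
  qed
next
  assume eq: "\<forall>g\<in>carrier K. character V g + character W' g = character V' g + character W g"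
  define U :: "'a crep" where "U = (0, \<lambda>_. 1\<^sub>m 0)"
  have U: "is_rep K U" by (auto simp: U_def is_rep_def)
  have "rep_iso K (rep_sum (rep_sum V W') U) (rep_sum (rep_sum V' W) U)"
    using assms U eq by (intro character_eq_imp_rep_iso[OF K fin]) (auto simp: character_sum[of K] is_rep_sum)
  with U show "groth_eq K (V, W) (V', W')" by (auto simp: groth_eq_def intro!: exI[of _ U] simp del: split_paired_Ex)
qed

section \<open>Induced representations\<close>

lemma (in group) mult_inv_cancel:
  assumes "x \<in> carrier G" "y \<in> carrier G"
  shows "x \<otimes> (inv x \<otimes> y) = y" "inv x \<otimes> (x \<otimes> y) = y"
  using assms by (simp_all add: m_assoc[symmetric])

lemma (in group) transversal_exists:
  assumes fin: "finite (carrier G)" and H: "subgroup H G"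
  shows "\<exists>ts. transversal G H ts"
proof -
  interpret H: subgroup H G by fact
  define f where "f g = (SOME x. x \<in> carrier G \<and> inv x \<otimes> g \<in> H)" for g
  have f: "f g \<in> carrier G \<and> inv (f g) \<otimes> g \<in> H" if "g \<in> carrier G" for g
    unfolding f_def by (rule someI[of _ g]) (use that in simp)
  \<comment> \<open>\<open>SOME\<close> applied to equal predicates gives equal elements, so it is
    enough that the predicates for \<open>g\<close> and \<open>g'\<close> agree. Thus
    \<open>f\<close> depends on the left coset only, and listing its values without repetition gives
    the transversal.\<close>
  have same: "f g = f g'" if g: "g \<in> carrier G" "g' \<in> carrier G" and gg: "inv g \<otimes> g' \<in> H" for g g'
  proof -
    have "inv x \<otimes> g \<in> H \<longleftrightarrow> inv x \<otimes> g' \<in> H" if x: "x \<in> carrier G" for x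
    proof
      assume "inv x \<otimes> g \<in> H"
      then have "(inv x \<otimes> g) \<otimes> (inv g \<otimes> g') \<in> H" using gg by simp
      then show "inv x \<otimes> g' \<in> H" using g x by (simp add: m_assoc mult_inv_cancel)
    next
      assume "inv x \<otimes> g' \<in> H"
      then have "(inv x \<otimes> g') \<otimes> inv (inv g \<otimes> g') \<in> H" using gg by simp
      then show "inv x \<otimes> g \<in> H" using g x by (simp add: m_assoc inv_mult_group mult_inv_cancel)
    qed
    then show ?thesis unfolding f_def by (metis (no_types, lifting))
  qed
  obtain ts where ts: "set ts = f ` carrier G" "distinct ts"
    using finite_distinct_list fin by (metis finite_imageI)
  have "\<exists>!i. i < length ts \<and> inv (ts ! i) \<otimes> g \<in> H" if g: "g \<in> carrier G" for g
  proof -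
    have "f g \<in> set ts" using g ts by simp
    then obtain i where i: "i < length ts" "ts ! i = f g" by (auto simp: in_set_conv_nth)
    moreover have "j = i" if j: "j < length ts" "inv (ts ! j) \<otimes> g \<in> H" for j
    proof -
      have "ts ! j \<in> f ` carrier G" using j(1) ts(1) nth_mem by blast
      then obtain g' where g': "g' \<in> carrier G" "ts ! j = f g'" by auto
      have "(inv (f g') \<otimes> g') \<in> H" "inv (f g') \<otimes> g \<in> H" using f[OF g'(1)] j(2) g'(2) by auto
      then have "inv (inv (f g') \<otimes> g') \<otimes> (inv (f g') \<otimes> g) \<in> H" by simp
      then have "inv g' \<otimes> g \<in> H"
        using g g'(1) f[OF g'(1)] by (simp add: inv_mult_group m_assoc mult_inv_cancel)
      then have "ts ! j = ts ! i" using same[OF g'(1) g] g' i by simp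
      then show "j = i" using ts(2) i(1) j(1) nth_eq_iff_index_eq by blast
    qed
    ultimately show ?thesis using f[OF g] by metis
  qed
  moreover have "set ts \<subseteq> carrier G" using ts f by auto
  ultimately show ?thesis unfolding transversal_def by blast
qed

text \<open>An index below \<open>m * n\<close> encodes a block number and a position inside the
  block, as in \<open>induce\<close>.\<close>

lemma sum_div_mod:
  fixes F :: "nat \<Rightarrow> nat \<Rightarrow> 'a::comm_monoid_add"
  shows "(\<Sum>q<m * n. F (q div n) (q mod n)) = (\<Sum>j<m. \<Sum>b<n. F j b)"
proof -
  have "(\<Sum>q = j * n..<j * n + n. F (q div n) (q mod n)) = (\<Sum>b<n. F j b)" for j
    by (rule sum.reindex_bij_witness[of _ "\<lambda>q. q - j * n" "\<lambda>b. j * n + b", symmetric]) auto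
  then show ?thesis
    using sum.nat_group[of "\<lambda>q. F (q div n) (q mod n)" n m] by simp
qed

lemma fst_induce: "fst (induce G H V) = length (SOME ts. transversal G H ts) * fst V"
  by (simp add: induce_def Let_def)

lemma snd_induce_index:
  assumes "r < fst (induce G H V)" "c < fst (induce G H V)"
  shows "snd (induce G H V) g $$ (r, c) =
    (let ts = (SOME ts. transversal G H ts); n = fst V;
         x = inv\<^bsub>G\<^esub> (ts ! (r div n)) \<otimes>\<^bsub>G\<^esub> g \<otimes>\<^bsub>G\<^esub> (ts ! (c div n))
     in if x \<in> H then snd V x $$ (r mod n, c mod n) else 0)"
  using assms by (simp add: induce_def Let_def)

lemma snd_induce_carrier: "snd (induce G H V) g \<in> carrier_mat (fst (induce G H V)) (fst (induce G H V))"
  by (simp add: induce_def Let_def)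

text \<open>A group element permutes the left cosets of \<open>H\<close>, so in every block of a
  product of two matrices only one summand survives, and that one is governed by multiplicativity of
  \<open>V\<close>.\<close>

lemma (in group) is_rep_induce:
  assumes fin: "finite (carrier G)" and H: "subgroup H G" and V: "is_rep (G\<lparr>carrier := H\<rparr>) V"
  shows "is_rep G (induce G H V)"
proof -
  interpret H: subgroup H G by fact
  define ts where "ts = (SOME ts. transversal G H ts)"
  have ts: "transversal G H ts" unfolding ts_def using transversal_exists[OF fin H] by (rule someI_ex)
  define m n \<rho> E where "m = length ts" and "n = fst V" and "\<rho> = snd V" and "E = snd (induce G H V)"
  have fstI: "fst (induce G H V) = m * n" by (simp add: fst_induce m_def n_def ts_def)
  have tc: "ts ! i \<in> carrier G" if "i < m" for i
    using ts that nth_mem unfolding transversal_def m_def by blast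
  have uniq: "\<exists>!i. i < m \<and> inv (ts ! i) \<otimes> g \<in> H" if "g \<in> carrier G" for g
    using ts that unfolding transversal_def m_def by blast
  define X where "X g i j = inv (ts ! i) \<otimes> g \<otimes> (ts ! j)" for g i j
  have E: "E g $$ (r, c) = (if X g (r div n) (c div n) \<in> H then \<rho> (X g (r div n) (c div n)) $$ (r mod n, c mod n) else 0)"
    if "r < m * n" "c < m * n" for g r c
    using snd_induce_index[of r G H V c g] that unfolding fstI
    by (simp add: E_def X_def Let_def ts_def n_def \<rho>_def)
  have cE: "E g \<in> carrier_mat (m * n) (m * n)" for g
    using snd_induce_carrier[of G H V g] by (simp add: E_def fstI)
  have c\<rho>: "\<rho> x \<in> carrier_mat n n" if "x \<in> H" for x
    using is_rep_carrier[OF V, of x] that by (simp add: \<rho>_def n_def)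
  have divmod: "q div n < m \<and> q mod n < n" if "q < m * n" for q
    using that by (metis less_mult_imp_div_less mod_less_divisor mult_0_right neq0_conv not_less0)
  have "E \<one> = 1\<^sub>m (m * n)"
  proof (rule eq_matI)
    fix r c assume "r < dim_row (1\<^sub>m (m * n) :: complex mat)" "c < dim_col (1\<^sub>m (m * n) :: complex mat)"
    then have rc: "r < m * n" "c < m * n" by auto
    note dr = divmod[OF rc(1)] and dc = divmod[OF rc(2)]
    have X1: "X \<one> (r div n) (c div n) = inv (ts ! (r div n)) \<otimes> ts ! (c div n)"
      using tc dr dc by (simp add: X_def)
    show "E \<one> $$ (r, c) = 1\<^sub>m (m * n) $$ (r, c)"
    proof (cases "r div n = c div n")
      case True
      have "X \<one> (r div n) (c div n) = \<one>" unfolding X1 using True tc dc by simp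
      moreover have "\<rho> \<one> = 1\<^sub>m n" using is_rep_one[OF V] by (simp add: \<rho>_def n_def)
      moreover have "r mod n = c mod n \<longleftrightarrow> r = c" using True by (metis div_mult_mod_eq)
      ultimately show ?thesis using rc dr dc by (simp add: E[OF rc])
    next
      case False
      \<comment> \<open>The element \<open>ts ! (c div n)\<close> lies in its own coset, hence by
        uniqueness in no other coset of the list; so the off-diagonal blocks vanish at the
        identity.\<close>
      have "inv (ts ! (c div n)) \<otimes> ts ! (c div n) \<in> H" using tc dc by simp
      then have "X \<one> (r div n) (c div n) \<notin> H"
        unfolding X1 using uniq[of "ts ! (c div n)"] tc dr dc False by blast
      moreover have "r \<noteq> c" using False by auto
      ultimately show ?thesis using rc by (simp add: E[OF rc])
    qed
  qed (use cE in auto)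
  moreover have "E (g \<otimes> h) = E g * E h" if gh: "g \<in> carrier G" "h \<in> carrier G" for g h
  proof (rule eq_matI)
    fix r c assume "r < dim_row (E g * E h)" "c < dim_col (E g * E h)"
    then have rc: "r < m * n" "c < m * n" using cE[of g] cE[of h] by auto
    define i a k b where "i = r div n" and "a = r mod n" and "k = c div n" and "b = c mod n"
    have ia: "i < m" "a < n" and kb: "k < m" "b < n"
      using divmod[OF rc(1)] divmod[OF rc(2)] by (auto simp: i_def a_def k_def b_def)
    \<comment> \<open>\<open>h\<close> maps the coset of \<open>ts ! k\<close> to that of
      \<open>ts ! j0\<close>, so this is the only block in column \<open>k\<close> of
      \<open>E h\<close> that is not set to 0.\<close>
    obtain j0 where j0: "j0 < m" "inv (ts ! j0) \<otimes> (h \<otimes> ts ! k) \<in> H"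
      and j0': "\<And>j. j < m \<Longrightarrow> inv (ts ! j) \<otimes> (h \<otimes> ts ! k) \<in> H \<Longrightarrow> j = j0"
      using uniq[of "h \<otimes> ts ! k"] gh tc kb by (metis m_closed)
    have X0: "X h j k \<in> H \<longleftrightarrow> j = j0" if "j < m" for j
      using j0 j0'[OF that] gh tc that kb by (auto simp: X_def m_assoc)
    have XX: "X g i j0 \<otimes> X h j0 k = X (g \<otimes> h) i k"
    proof -
      have "ts ! j0 \<otimes> (inv (ts ! j0) \<otimes> z) = z" if "z \<in> carrier G" for z
        using tc[OF j0(1)] that by (simp add: m_assoc[symmetric])
      then show ?thesis using gh tc ia kb j0(1) by (simp add: X_def m_assoc)
    qed
    have XH: "X g i j0 \<in> H \<longleftrightarrow> X (g \<otimes> h) i k \<in> H"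
    proof
      assume "X g i j0 \<in> H"
      then show "X (g \<otimes> h) i k \<in> H" using X0[OF j0(1)] XX[symmetric] by simp
    next
      assume "X (g \<otimes> h) i k \<in> H"
      then have "X g i j0 \<otimes> X h j0 k \<otimes> inv (X h j0 k) \<in> H"
        unfolding XX using X0[OF j0(1)] by simp
      moreover have "X g i j0 \<in> carrier G" "X h j0 k \<in> carrier G" using gh tc ia kb j0(1) by (auto simp: X_def)
      ultimately show "X g i j0 \<in> H" by (simp add: m_assoc)
    qed
    define F where "F j l = (if X g i j \<in> H then \<rho> (X g i j) $$ (a, l) else 0) *
        (if X h j k \<in> H then \<rho> (X h j k) $$ (l, b) else 0)" for j l
    have "(E g * E h) $$ (r, c) = (\<Sum>q<m * n. E g $$ (r, q) * E h $$ (q, c))"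
      by (rule index_mult_mat_sum[OF cE cE rc])
    also have "\<dots> = (\<Sum>q<m * n. F (q div n) (q mod n))"
      using rc by (intro sum.cong refl) (simp add: E F_def i_def a_def k_def b_def)
    also have "\<dots> = (\<Sum>j<m. \<Sum>l<n. F j l)" by (rule sum_div_mod)
    also have "\<dots> = (\<Sum>j<m. if j = j0 then \<Sum>l<n. F j0 l else 0)"
      using X0 by (intro sum.cong refl) (auto simp: F_def)
    also have "\<dots> = (\<Sum>l<n. F j0 l)" using j0(1) by (simp add: sum.delta)
    also have "\<dots> = (if X (g \<otimes> h) i k \<in> H then \<rho> (X (g \<otimes> h) i k) $$ (a, b) else 0)"
    proof (cases "X (g \<otimes> h) i k \<in> H")
      case True
      then have in_H: "X g i j0 \<in> H" "X h j0 k \<in> H" using XH X0[OF j0(1)] by auto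
      have "\<rho> (X (g \<otimes> h) i k) = \<rho> (X g i j0) * \<rho> (X h j0 k)"
        using is_rep_mult[OF V, of "X g i j0" "X h j0 k"] in_H by (simp add: XX \<rho>_def)
      then show ?thesis
        using True in_H index_mult_mat_sum[OF c\<rho> c\<rho> ia(2) kb(2)] by (simp add: F_def)
    qed (simp add: F_def XH)
    also have "\<dots> = E (g \<otimes> h) $$ (r, c)" by (simp add: E[OF rc] i_def a_def k_def b_def)
    finally show "E (g \<otimes> h) $$ (r, c) = (E g * E h) $$ (r, c)" ..
  qed (use cE[of g] cE[of h] cE[of "g \<otimes> h"] in auto)
  ultimately show ?thesis
    using cE by (auto simp: is_rep_def fstI E_def)
qed

lemma (in group) is_real_rep_induce:
  assumes fin: "finite (carrier G)" and H: "subgroup H G" and V: "is_real_rep (G\<lparr>carrier := H\<rparr>) V"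
  shows "is_real_rep G (induce G H V)"
  unfolding is_real_rep_def
proof (intro conjI ballI allI impI)
  show "is_rep G (induce G H V)" using is_rep_induce[OF fin H] V by (simp add: is_real_rep_def)
  fix g r c assume rc: "r < fst (induce G H V)" "c < fst (induce G H V)"
  \<comment> \<open>Positivity makes the residues valid indices; in degree 0 there is no row
    \<open>r\<close> at all.\<close>
  have "fst V > 0" using rc by (cases "fst V") (auto simp: fst_induce)
  then have "snd V x $$ (r mod fst V, c mod fst V) \<in> \<real>" if "x \<in> H" for x
    using V that by (simp add: is_real_rep_def)
  then show "snd (induce G H V) g $$ (r, c) \<in> \<real>"
    unfolding snd_induce_index[OF rc] by (simp add: Let_def)
qed

text \<open>Frobenius' formula for induced class functions. Summing over all of \<open>G\<close> and
  dividing by \<open>card H\<close> avoids the choice of a transversal, and \<open>f\<close> may be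
  any function.\<close>

definition ind_fun :: "('g, 'b) monoid_scheme \<Rightarrow> 'g set \<Rightarrow> ('g \<Rightarrow> complex) \<Rightarrow> 'g \<Rightarrow> complex" where
  "ind_fun G H f g = (\<Sum>x\<in>carrier G. if inv\<^bsub>G\<^esub> x \<otimes>\<^bsub>G\<^esub> g \<otimes>\<^bsub>G\<^esub> x \<in> H
      then f (inv\<^bsub>G\<^esub> x \<otimes>\<^bsub>G\<^esub> g \<otimes>\<^bsub>G\<^esub> x) else 0) / of_nat (card H)"

lemma character_conj:
  assumes K: "group K" and V: "is_rep K V" and xy: "x \<in> carrier K" "y \<in> carrier K"
  shows "character V (inv\<^bsub>K\<^esub> x \<otimes>\<^bsub>K\<^esub> y \<otimes>\<^bsub>K\<^esub> x) = character V y"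
proof -
  interpret group K by fact
  have xi: "inv\<^bsub>K\<^esub> x \<in> carrier K" using xy by simp
  note c = is_rep_carrier[OF V]
  have "mat_trace (snd V (inv\<^bsub>K\<^esub> x \<otimes>\<^bsub>K\<^esub> y) * snd V x) = mat_trace (snd V x * snd V (inv\<^bsub>K\<^esub> x \<otimes>\<^bsub>K\<^esub> y))"
    using c[of "inv\<^bsub>K\<^esub> x \<otimes>\<^bsub>K\<^esub> y"] c[OF xy(1)] xy xi
    by (intro mat_trace_mult_commute[of _ "fst V" "fst V"]) auto
  then show ?thesis
    using xy xi by (simp add: character_def is_rep_mult[OF V, symmetric] m_assoc[symmetric])
qed

text \<open>Only diagonal blocks contribute to the trace, which gives a sum over the transversal.
  The summand is constant on left cosets of \<open>H\<close>, so summing over \<open>G\<close>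
  instead multiplies the result by \<open>card H\<close>.\<close>

lemma (in group) character_induce:
  assumes fin: "finite (carrier G)" and H: "subgroup H G" and V: "is_rep (G\<lparr>carrier := H\<rparr>) V"
    and g: "g \<in> carrier G"
  shows "character (induce G H V) g = ind_fun G H (character V) g"
proof -
  interpret H: subgroup H G by fact
  define ts where "ts = (SOME ts. transversal G H ts)"
  have ts: "transversal G H ts" unfolding ts_def using transversal_exists[OF fin H] by (rule someI_ex)
  define m n where "m = length ts" and "n = fst V"
  have fstI: "fst (induce G H V) = m * n" by (simp add: fst_induce m_def n_def ts_def)
  have tc: "ts ! i \<in> carrier G" if "i < m" for i
    using ts that nth_mem unfolding transversal_def m_def by blast
  have uniq: "\<exists>!i. i < m \<and> inv (ts ! i) \<otimes> x \<in> H" if "x \<in> carrier G" for x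
    using ts that unfolding transversal_def m_def by blast
  define X where "X x = inv x \<otimes> g \<otimes> x" for x
  define \<phi> where "\<phi> x = (if X x \<in> H then character V (X x) else 0)" for x
  have finH: "finite H" using fin H.subset finite_subset by blast
  have cardH: "card H \<noteq> 0" using finH H.one_closed by (metis card_0_eq empty_iff)
  have "character (induce G H V) g = (\<Sum>r<m * n. if X (ts ! (r div n)) \<in> H
      then snd V (X (ts ! (r div n))) $$ (r mod n, r mod n) else 0)"
    using snd_induce_carrier[of G H V g] unfolding character_def mat_trace_def
    by (intro sum.cong) (auto simp: fstI snd_induce_index Let_def X_def n_def ts_def)
  also have "\<dots> = (\<Sum>i<m. \<Sum>a<n. if X (ts ! i) \<in> H then snd V (X (ts ! i)) $$ (a, a) else 0)"
    by (rule sum_div_mod)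
  also have "\<dots> = (\<Sum>i<m. \<phi> (ts ! i))"
  proof (intro sum.cong refl)
    fix i
    show "(\<Sum>a<n. if X (ts ! i) \<in> H then snd V (X (ts ! i)) $$ (a, a) else 0) = \<phi> (ts ! i)"
      using is_rep_carrier[OF V, of "X (ts ! i)"]
      by (auto simp: \<phi>_def character_def mat_trace_def n_def)
  qed
  finally have 1: "character (induce G H V) g = (\<Sum>i<m. \<phi> (ts ! i))" .
  \<comment> \<open>Each element of \<open>G\<close> is uniquely a transversal element times an
    element of \<open>H\<close>.\<close>
  have "bij_betw (\<lambda>(i, h). ts ! i \<otimes> h) ({..<m} \<times> H) (carrier G)"
    unfolding bij_betw_def
  proof
    show "inj_on (\<lambda>(i, h). ts ! i \<otimes> h) ({..<m} \<times> H)"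
    proof (rule inj_onI, clarsimp)
      fix i h j k assume *: "i < m" "h \<in> H" "j < m" "k \<in> H" "ts ! i \<otimes> h = ts ! j \<otimes> k"
      have "inv (ts ! i) \<otimes> (ts ! i \<otimes> h) \<in> H" "inv (ts ! j) \<otimes> (ts ! j \<otimes> k) \<in> H"
        using *(1-4) tc by (simp_all add: m_assoc[symmetric])
      then have "i = j" using uniq[of "ts ! i \<otimes> h"] * tc by (metis H.mem_carrier m_closed)
      then show "i = j \<and> h = k" using * tc by simp
    qed
    show "(\<lambda>(i, h). ts ! i \<otimes> h) ` ({..<m} \<times> H) = carrier G"
    proof (intro equalityI subsetI)
      fix x assume x: "x \<in> carrier G"
      then obtain i where i: "i < m" "inv (ts ! i) \<otimes> x \<in> H" using uniq by blast
      have "x = ts ! i \<otimes> (inv (ts ! i) \<otimes> x)" using tc[OF i(1)] x by (simp add: m_assoc[symmetric])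
      then show "x \<in> (\<lambda>(i, h). ts ! i \<otimes> h) ` ({..<m} \<times> H)" using i by force
    qed (use tc in auto)
  qed
  then have "(\<Sum>x\<in>carrier G. \<phi> x) = (\<Sum>(i, h)\<in>{..<m} \<times> H. \<phi> (ts ! i \<otimes> h))"
    by (subst sum.reindex_bij_betw[symmetric]) (auto simp: case_prod_unfold)
  \<comment> \<open>Multiplying \<open>ts ! i\<close> by \<open>h\<close> on the right conjugates
    \<open>X (ts ! i)\<close> inside \<open>H\<close>, which changes neither membership in
    \<open>H\<close> nor the character.\<close>
  also have "\<dots> = (\<Sum>i<m. \<Sum>h\<in>H. \<phi> (ts ! i))"
  proof (subst sum.cartesian_product[symmetric], intro sum.cong refl)
    fix i h assume i: "i \<in> {..<m}" and h: "h \<in> H"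
    have c: "ts ! i \<in> carrier G" "h \<in> carrier G" using tc i h by auto
    have eq: "X (ts ! i \<otimes> h) = inv h \<otimes> X (ts ! i) \<otimes> h"
      using c g by (simp add: X_def inv_mult_group m_assoc)
    have "X (ts ! i) = h \<otimes> X (ts ! i \<otimes> h) \<otimes> inv h"
      using c g unfolding eq by (simp add: X_def m_assoc mult_inv_cancel)
    then have "X (ts ! i \<otimes> h) \<in> H \<longleftrightarrow> X (ts ! i) \<in> H"
      using eq h by (metis H.m_closed H.m_inv_closed)
    moreover have "character V (inv h \<otimes> X (ts ! i) \<otimes> h) = character V (X (ts ! i))" if "X (ts ! i) \<in> H"
      using character_conj[OF subgroup_imp_group[OF H] V, of h "X (ts ! i)"] h that
        m_inv_consistent[OF H h] by simp
    ultimately show "\<phi> (ts ! i \<otimes> h) = \<phi> (ts ! i)" by (simp add: \<phi>_def eq)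
  qed
  also have "\<dots> = of_nat (card H) * (\<Sum>i<m. \<phi> (ts ! i))" by (simp add: sum_distrib_left)
  finally have "(\<Sum>x\<in>carrier G. \<phi> x) = of_nat (card H) * (\<Sum>i<m. \<phi> (ts ! i))" .
  moreover have "ind_fun G H (character V) g = (\<Sum>x\<in>carrier G. \<phi> x) / of_nat (card H)"
    unfolding ind_fun_def \<phi>_def X_def ..
  ultimately show ?thesis using cardH by (simp add: 1)
qed

text \<open>The double sum over \<open>x\<close> in \<open>G\<close> and \<open>y\<close> in
  \<open>H\<close> has a summand that depends on the product \<open>x y\<close> only, and every
  element of \<open>G\<close> is such a product in \<open>card H\<close> ways.\<close>

lemma (in group) ind_fun_trans:
  assumes fin: "finite (carrier G)" and H: "subgroup H G" and C: "subgroup C G" "C \<subseteq> H" and g: "g \<in> carrier G"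
  shows "ind_fun G H (ind_fun (G\<lparr>carrier := H\<rparr>) C f) g = ind_fun G C f g"
proof -
  interpret H: subgroup H G by fact
  have finH: "finite H" using fin H.subset finite_subset by blast
  have cardH: "card H \<noteq> 0" using finH H.one_closed by (metis card_0_eq empty_iff)
  define F where "F x = (if inv x \<otimes> g \<otimes> x \<in> C then f (inv x \<otimes> g \<otimes> x) else 0)" for x
  have "(if inv x \<otimes> g \<otimes> x \<in> H then ind_fun (G\<lparr>carrier := H\<rparr>) C f (inv x \<otimes> g \<otimes> x) else 0) =
      (\<Sum>y\<in>H. F (x \<otimes> y)) / of_nat (card C)" if x: "x \<in> carrier G" for x
  proof -
    have eq: "inv (x \<otimes> y) \<otimes> g \<otimes> (x \<otimes> y) = inv y \<otimes> (inv x \<otimes> g \<otimes> x) \<otimes> y" if "y \<in> H" for y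
      using that x g by (simp add: inv_mult_group m_assoc)
    show ?thesis
    proof (cases "inv x \<otimes> g \<otimes> x \<in> H")
      case True
      then show ?thesis
        by (auto simp: ind_fun_def F_def eq m_inv_consistent[OF H] intro!: arg_cong2[of _ _ _ _ "(/)"] sum.cong)
    next
      case False
      \<comment> \<open>An element outside \<open>H\<close> has all its conjugates under
        \<open>H\<close> outside \<open>H\<close>, hence outside \<open>C\<close>.\<close>
      have "F (x \<otimes> y) = 0" if y: "y \<in> H" for y
      proof -
        have "inv y \<otimes> (inv x \<otimes> g \<otimes> x) \<otimes> y \<notin> H"
        proof
          assume "inv y \<otimes> (inv x \<otimes> g \<otimes> x) \<otimes> y \<in> H"
          then have "y \<otimes> (inv y \<otimes> (inv x \<otimes> g \<otimes> x) \<otimes> y) \<otimes> inv y \<in> H" using y by simp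
          moreover have "y \<otimes> (inv y \<otimes> (inv x \<otimes> g \<otimes> x) \<otimes> y) \<otimes> inv y = inv x \<otimes> g \<otimes> x"
            using y x g by (simp add: m_assoc mult_inv_cancel)
          ultimately show False using False by simp
        qed
        then show ?thesis using C(2) eq[OF y] by (auto simp: F_def)
      qed
      then show ?thesis using False by simp
    qed
  qed
  then have "ind_fun G H (ind_fun (G\<lparr>carrier := H\<rparr>) C f) g =
      (\<Sum>x\<in>carrier G. (\<Sum>y\<in>H. F (x \<otimes> y)) / of_nat (card C)) / of_nat (card H)"
    by (simp add: ind_fun_def[of G H])
  also have "\<dots> = (\<Sum>y\<in>H. \<Sum>x\<in>carrier G. F (x \<otimes> y)) / of_nat (card C) / of_nat (card H)"
    by (subst sum.swap) (simp add: sum_divide_distrib)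
  \<comment> \<open>Right translation by \<open>y\<close> permutes \<open>G\<close>, so the inner
    sum does not depend on \<open>y\<close>.\<close>
  also have "(\<Sum>y\<in>H. \<Sum>x\<in>carrier G. F (x \<otimes> y)) = (\<Sum>y\<in>H. \<Sum>x\<in>carrier G. F x)"
  proof (rule sum.cong[OF refl])
    fix y assume y: "y \<in> H"
    have "bij_betw (\<lambda>x. x \<otimes> y) (carrier G) (carrier G)"
      by (rule bij_betwI[of _ _ _ "\<lambda>x. x \<otimes> inv y"]) (use y in \<open>auto simp: m_assoc\<close>)
    then show "(\<Sum>x\<in>carrier G. F (x \<otimes> y)) = (\<Sum>x\<in>carrier G. F x)" by (rule sum.reindex_bij_betw)
  qed
  finally show ?thesis using cardH by (simp add: ind_fun_def[of G C] F_def)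
qed

text \<open>Replacing the summation variable \<open>x\<close> by \<open>x t\<close> matches the two
  sums. The conjugate of \<open>C\<close> by \<open>t\<close> is described by the membership test
  that occurs in \<open>ind_fun\<close>.\<close>

lemma (in group) ind_fun_conj:
  assumes C: "C \<subseteq> carrier G" and t: "t \<in> carrier G" and g: "g \<in> carrier G"
  shows "ind_fun G {z \<in> carrier G. inv t \<otimes> z \<otimes> t \<in> C} (\<lambda>z. f (inv t \<otimes> z \<otimes> t)) g = ind_fun G C f g"
proof -
  have "bij_betw (\<lambda>z. inv t \<otimes> z \<otimes> t) {z \<in> carrier G. inv t \<otimes> z \<otimes> t \<in> C} C"
  proof (rule bij_betwI[of _ _ _ "\<lambda>c. t \<otimes> c \<otimes> inv t"])
    have *: "inv t \<otimes> (t \<otimes> c \<otimes> inv t) \<otimes> t = c" if "c \<in> carrier G" for c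
      using t that by (simp add: m_assoc mult_inv_cancel)
    show "(\<lambda>c. t \<otimes> c \<otimes> inv t) \<in> C \<rightarrow> {z \<in> carrier G. inv t \<otimes> z \<otimes> t \<in> C}"
      using t C * by auto
    show "inv t \<otimes> (t \<otimes> c \<otimes> inv t) \<otimes> t = c" if "c \<in> C" for c
      using * that C by auto
    show "t \<otimes> (inv t \<otimes> z \<otimes> t) \<otimes> inv t = z" if "z \<in> {z \<in> carrier G. inv t \<otimes> z \<otimes> t \<in> C}" for z
      using t that by (simp add: m_assoc mult_inv_cancel)
  qed auto
  then have card: "card {z \<in> carrier G. inv t \<otimes> z \<otimes> t \<in> C} = card C" by (rule bij_betw_same_card)
  have bij: "bij_betw (\<lambda>x. x \<otimes> t) (carrier G) (carrier G)"
    by (rule bij_betwI[of _ _ _ "\<lambda>x. x \<otimes> inv t"]) (use t in \<open>auto simp: m_assoc\<close>)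
  have eq: "inv t \<otimes> (inv x \<otimes> g \<otimes> x) \<otimes> t = inv (x \<otimes> t) \<otimes> g \<otimes> (x \<otimes> t)" if "x \<in> carrier G" for x
    using that t g by (simp add: inv_mult_group m_assoc)
  show ?thesis
    unfolding ind_fun_def card using g t
    by (subst (2) sum.reindex_bij_betw[OF bij, symmetric])
      (auto simp: eq intro!: arg_cong2[of _ _ _ _ "(/)"] sum.cong)
qed

lemma ind_fun_cong: "(\<And>x. x \<in> H \<Longrightarrow> f x = f' x) \<Longrightarrow> ind_fun G H f g = ind_fun G H f' g"
  unfolding ind_fun_def by (intro arg_cong2[of _ _ _ _ "(/)"] sum.cong) auto

lemma ind_fun_sum:
  "ind_fun G H (\<lambda>x. \<Sum>k\<in>S. c k * f k x) g = (\<Sum>k\<in>S. c k * ind_fun G H (f k) g)"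
proof -
  have "(\<Sum>k\<in>S. c k * ind_fun G H (f k) g) = (\<Sum>k\<in>S. \<Sum>x\<in>carrier G. c k *
      (if inv\<^bsub>G\<^esub> x \<otimes>\<^bsub>G\<^esub> g \<otimes>\<^bsub>G\<^esub> x \<in> H then f k (inv\<^bsub>G\<^esub> x \<otimes>\<^bsub>G\<^esub> g \<otimes>\<^bsub>G\<^esub> x) else 0) / of_nat (card H))"
    by (simp add: ind_fun_def sum_distrib_left sum_divide_distrib)
  also have "\<dots> = ind_fun G H (\<lambda>x. \<Sum>k\<in>S. c k * f k x) g"
    by (subst sum.swap) (auto simp: ind_fun_def sum_divide_distrib intro!: sum.cong)
  finally show ?thesis ..
qed

section \<open>Fusion\<close>

definition conj_rep :: "('g, 'b) monoid_scheme \<Rightarrow> 'g \<Rightarrow> 'g crep \<Rightarrow> 'g crep" where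
  "conj_rep G t V = (fst V, \<lambda>z. snd V (inv\<^bsub>G\<^esub> t \<otimes>\<^bsub>G\<^esub> z \<otimes>\<^bsub>G\<^esub> t))"

context group
begin

context
  fixes C t C'
  assumes C: "subgroup C G" and t: "t \<in> carrier G"
  defines "C' \<equiv> {z \<in> carrier G. inv t \<otimes> z \<otimes> t \<in> C}"
begin

lemma conj_subgroup: "subgroup C' G"
proof -
  interpret C: subgroup C G by (rule C)
  show ?thesis
  proof (rule subgroupI)
    show "C' \<noteq> {}" using t by (auto simp: C'_def intro!: exI[of _ \<one>])
    fix a b assume a: "a \<in> C'" and b: "b \<in> C'"
    have "inv (inv t \<otimes> a \<otimes> t) \<in> C" using a by (simp add: C'_def)
    then show "inv a \<in> C'" using a t by (simp add: C'_def inv_mult_group m_assoc)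
    have "(inv t \<otimes> a \<otimes> t) \<otimes> (inv t \<otimes> b \<otimes> t) \<in> C" using a b by (simp add: C'_def)
    then show "a \<otimes> b \<in> C'" using a b t by (simp add: C'_def m_assoc mult_inv_cancel)
  qed (auto simp: C'_def)
qed

lemma is_rep_conj_rep:
  assumes V: "is_rep (G\<lparr>carrier := C\<rparr>) V"
  shows "is_rep (G\<lparr>carrier := C'\<rparr>) (conj_rep G t V)"
  unfolding is_rep_def
proof (intro conjI ballI)
  fix a b assume "a \<in> carrier (G\<lparr>carrier := C'\<rparr>)" "b \<in> carrier (G\<lparr>carrier := C'\<rparr>)"
  then have ab: "a \<in> carrier G" "inv t \<otimes> a \<otimes> t \<in> C" "b \<in> carrier G" "inv t \<otimes> b \<otimes> t \<in> C"
    by (auto simp: C'_def)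
  have "inv t \<otimes> (a \<otimes> b) \<otimes> t = (inv t \<otimes> a \<otimes> t) \<otimes> (inv t \<otimes> b \<otimes> t)"
    using ab t by (simp add: m_assoc mult_inv_cancel)
  then show "snd (conj_rep G t V) (a \<otimes>\<^bsub>G\<lparr>carrier := C'\<rparr>\<^esub> b) = snd (conj_rep G t V) a * snd (conj_rep G t V) b"
    using is_rep_mult[OF V, of "inv t \<otimes> a \<otimes> t" "inv t \<otimes> b \<otimes> t"] ab by (simp add: conj_rep_def)
next
  show "snd (conj_rep G t V) \<one>\<^bsub>G\<lparr>carrier := C'\<rparr>\<^esub> = 1\<^sub>m (fst (conj_rep G t V))"
    using is_rep_one[OF V] t by (simp add: conj_rep_def)
qed (use is_rep_carrier[OF V] in \<open>auto simp: conj_rep_def C'_def\<close>)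

lemma is_real_rep_conj_rep:
  assumes "is_real_rep (G\<lparr>carrier := C\<rparr>) V"
  shows "is_real_rep (G\<lparr>carrier := C'\<rparr>) (conj_rep G t V)"
  using assms is_rep_conj_rep[of V] by (auto simp: is_real_rep_def conj_rep_def C'_def)

text \<open>\<open>Ind\<^sub>C\<^sup>H V\<close> and \<open>Ind\<^sub>C\<^sub>'\<^sup>H V\<^sup>t\<close> become isomorphic after induction to \<open>G\<close>, since
  \<open>C'\<close> and \<open>C\<close> are conjugate there.\<close>

lemma ind_conj_cancel:
  assumes fin: "finite (carrier G)" and H: "subgroup H G" and CH: "C \<subseteq> H" "C' \<subseteq> H"
    and V: "is_rep (G\<lparr>carrier := C\<rparr>) V"
  defines "A \<equiv> induce (G\<lparr>carrier := H\<rparr>) C V"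
    and "B \<equiv> induce (G\<lparr>carrier := H\<rparr>) C' (conj_rep G t V)"
  assumes mono: "groth_eq G (induce G H A, induce G H A) (induce G H B, induce G H A) \<Longrightarrow>
      groth_eq (G\<lparr>carrier := H\<rparr>) (A, A) (B, A)"
    and y: "y \<in> H"
  shows "ind_fun (G\<lparr>carrier := H\<rparr>) C (character V) y =
    ind_fun (G\<lparr>carrier := H\<rparr>) C' (\<lambda>z. character V (inv t \<otimes> z \<otimes> t)) y"
proof -
  interpret H: subgroup H G by fact
  have K: "group (G\<lparr>carrier := H\<rparr>)" by (rule subgroup_imp_group[OF H])
  have finH: "finite (carrier (G\<lparr>carrier := H\<rparr>))" using fin H.subset finite_subset by auto
  have CK: "subgroup C (G\<lparr>carrier := H\<rparr>)" and CK': "subgroup C' (G\<lparr>carrier := H\<rparr>)"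
    using subgroup_incl C conj_subgroup H CH by auto
  have V': "is_rep (G\<lparr>carrier := C'\<rparr>) (conj_rep G t V)" by (rule is_rep_conj_rep[OF V])
  have AB: "is_rep (G\<lparr>carrier := H\<rparr>) A" "is_rep (G\<lparr>carrier := H\<rparr>) B"
    unfolding A_def B_def using V V' by (auto intro!: group.is_rep_induce[OF K finH] CK CK')
  have chi: "character A z = ind_fun (G\<lparr>carrier := H\<rparr>) C (character V) z"
    "character B z = ind_fun (G\<lparr>carrier := H\<rparr>) C' (\<lambda>z. character V (inv t \<otimes> z \<otimes> t)) z" if "z \<in> H" for z
    using group.character_induce[OF K finH CK, of V z] group.character_induce[OF K finH CK', of "conj_rep G t V" z]
      V V' that by (simp_all add: A_def B_def character_def[abs_def] conj_rep_def)
  have ind: "ind_fun G H (character A) g = ind_fun G H (character B) g" if g: "g \<in> carrier G" for g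
  proof -
    have "ind_fun G H (character A) g = ind_fun G H (ind_fun (G\<lparr>carrier := H\<rparr>) C (character V)) g"
      by (rule ind_fun_cong) (rule chi(1))
    also have "\<dots> = ind_fun G C (character V) g"
      by (rule ind_fun_trans[OF fin H C CH(1) g])
    also have "\<dots> = ind_fun G C' (\<lambda>z. character V (inv t \<otimes> z \<otimes> t)) g"
      unfolding C'_def using subgroup.subset[OF C] by (rule ind_fun_conj[OF _ t g, symmetric])
    also have "\<dots> = ind_fun G H (ind_fun (G\<lparr>carrier := H\<rparr>) C' (\<lambda>z. character V (inv t \<otimes> z \<otimes> t))) g"
      by (rule ind_fun_trans[OF fin H conj_subgroup CH(2) g, symmetric])
    also have "\<dots> = ind_fun G H (character B) g"
      by (rule ind_fun_cong) (rule chi(2)[symmetric])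
    finally show ?thesis .
  qed
  \<comment> \<open>The two formal differences are 0 and \<open>B - A\<close>. The hypothesis
    \<open>mono\<close> is this single instance of injectivity, so that the complex and the real
    case can each supply it.\<close>
  have "groth_eq G (induce G H A, induce G H A) (induce G H B, induce G H A)"
    using AB ind by (simp add: groth_eq_iff_character[OF is_group fin] is_rep_induce[OF fin H]
        character_induce[OF fin H])
  from mono[OF this] have "character A y = character B y"
    using AB y by (simp add: groth_eq_iff_character[OF K finH])
  then show ?thesis using chi[OF y] by simp
qed

text \<open>A combination of the \<open>f k\<close> is a weight \<open>w\<close> on
  \<open>C\<close>, so \<open>w\<close> and its transport to \<open>C'\<close> induce the same value
  at the conjugate of \<open>h\<close> by \<open>t\<close>. The transport contributes
  \<open>w h\<close> there, and natural numbers cannot cancel; hence some further conjugate under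
  \<open>H\<close> lies in \<open>C\<close> with nonzero weight.\<close>

lemma exists_conj_of_ind_fun_eq:
  assumes fin: "finite (carrier G)" and H: "subgroup H G"
    and eq: "\<And>k y. k < N \<Longrightarrow> y \<in> H \<Longrightarrow> ind_fun (G\<lparr>carrier := H\<rparr>) C (f k) y =
      ind_fun (G\<lparr>carrier := H\<rparr>) C' (\<lambda>z. f k (inv t \<otimes> z \<otimes> t)) y"
    and w: "\<And>x. x \<in> C \<Longrightarrow> (\<Sum>k<N. c k * f k x) = of_nat (w x)"
    and h: "h \<in> C" "w h \<noteq> 0" and y: "t \<otimes> h \<otimes> inv t \<in> H"
  shows "\<exists>x\<in>H. inv x \<otimes> (t \<otimes> h \<otimes> inv t) \<otimes> x \<in> C \<and> w (inv x \<otimes> (t \<otimes> h \<otimes> inv t) \<otimes> x) \<noteq> 0"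
proof (rule ccontr)
  assume none: "\<not> ?thesis"
  interpret H: subgroup H G by fact
  interpret C: subgroup C G by (rule C)
  define y where "y = t \<otimes> h \<otimes> inv t"
  have yH: "y \<in> H" using assms(7) by (simp add: y_def)
  have hG: "h \<in> carrier G" using h C.mem_carrier by blast
  have finH: "finite H" using fin H.subset finite_subset by blast
  have finC': "finite C'" using fin by (simp add: C'_def)
  have inv_H: "inv\<^bsub>G\<lparr>carrier := H\<rparr>\<^esub> x = inv x" if "x \<in> H" for x
    by (rule m_inv_consistent[OF H that])
  have conj_y: "inv t \<otimes> y \<otimes> t = h" using t hG by (simp add: y_def m_assoc mult_inv_cancel)
  have yC': "y \<in> C'" using conj_y h t hG by (simp add: C'_def y_def)
  have "ind_fun (G\<lparr>carrier := H\<rparr>) C (\<lambda>x. \<Sum>k<N. c k * f k x) y =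
      ind_fun (G\<lparr>carrier := H\<rparr>) C' (\<lambda>z. \<Sum>k<N. c k * f k (inv t \<otimes> z \<otimes> t)) y"
    using eq[OF _ yH] unfolding ind_fun_sum by (intro sum.cong refl) simp
  moreover have "ind_fun (G\<lparr>carrier := H\<rparr>) C (\<lambda>x. \<Sum>k<N. c k * f k x) y = 0"
  proof -
    have "ind_fun (G\<lparr>carrier := H\<rparr>) C (\<lambda>x. \<Sum>k<N. c k * f k x) y =
        ind_fun (G\<lparr>carrier := H\<rparr>) C (\<lambda>x. of_nat (w x)) y"
      by (rule ind_fun_cong) (rule w)
    also have "\<dots> = 0"
      using none by (auto simp: ind_fun_def y_def[symmetric] inv_H intro!: sum.neutral)
    finally show ?thesis .
  qed
  moreover have "ind_fun (G\<lparr>carrier := H\<rparr>) C' (\<lambda>z. \<Sum>k<N. c k * f k (inv t \<otimes> z \<otimes> t)) y \<noteq> 0"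
  proof -
    define F where "F x = (if inv x \<otimes> y \<otimes> x \<in> C' then w (inv t \<otimes> (inv x \<otimes> y \<otimes> x) \<otimes> t) else 0)" for x
    have "ind_fun (G\<lparr>carrier := H\<rparr>) C' (\<lambda>z. \<Sum>k<N. c k * f k (inv t \<otimes> z \<otimes> t)) y =
        ind_fun (G\<lparr>carrier := H\<rparr>) C' (\<lambda>z. of_nat (w (inv t \<otimes> z \<otimes> t))) y"
      by (rule ind_fun_cong) (auto simp: C'_def w)
    also have "\<dots> = of_nat (\<Sum>x\<in>H. F x) / of_nat (card C')"
      by (auto simp: ind_fun_def F_def inv_H intro!: sum.cong)
    finally have "ind_fun (G\<lparr>carrier := H\<rparr>) C' (\<lambda>z. \<Sum>k<N. c k * f k (inv t \<otimes> z \<otimes> t)) y =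
        of_nat (\<Sum>x\<in>H. F x) / of_nat (card C')" .
    \<comment> \<open>The identity contributes \<open>w h\<close>, since conjugating
      \<open>y\<close> back by \<open>t\<close> gives \<open>h\<close>.\<close>
    moreover have "F \<one> \<noteq> 0"
      using yC' h(2) conj_y yH by (simp add: F_def)
    then have "(\<Sum>x\<in>H. F x) \<noteq> 0" using finH H.one_closed by (metis sum_eq_0_iff)
    moreover have "card C' \<noteq> 0" using finC' yC' by (metis card_0_eq empty_iff)
    ultimately show ?thesis by (simp only: divide_eq_0_iff of_nat_eq_0_iff) simp
  qed
  ultimately show False by simp
qed

end

text \<open>\<open>N\<close> is the order of \<open>h\<close>, and \<open>e\<close> sends
  \<open>h [^] k\<close> to the \<open>k\<close>-th power of a primitive \<open>N\<close>-th root of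
  unity. Both powers are determined by, and determine, the exponent modulo \<open>N\<close>, which
  makes \<open>e\<close> multiplicative and injective.\<close>

lemma cyclic_character:
  assumes fin: "finite (carrier G)" and h: "h \<in> carrier G"
  obtains e :: "'a \<Rightarrow> complex" and N :: nat where "N > 0"
    "\<And>x. x \<in> generate G {h} \<Longrightarrow> e x ^ N = 1"
    "\<And>x. x \<in> generate G {h} \<Longrightarrow> norm (e x) = 1"
    "\<And>x y. x \<in> generate G {h} \<Longrightarrow> y \<in> generate G {h} \<Longrightarrow> e (x \<otimes> y) = e x * e y"
    "inj_on e (generate G {h})"
proof -
  define N where "N = ord h"
  have N: "N > 0" using ord_ge_1[OF fin h] by (simp add: N_def)
  have gen: "generate G {h} = {h [^] k | k. k \<in> (UNIV :: nat set)}"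
    by (rule generate_pow_on_finite_carrier[OF fin h])
  define \<omega> where "\<omega> = cis (2 * pi / real N)"
  \<comment> \<open>A discrete logarithm: an arbitrary exponent, determined only modulo
    \<open>N\<close>. Powers of the root of unity do not see the ambiguity.\<close>
  define dlog where "dlog x = (SOME k::nat. x = h [^] k)" for x
  define e where "e x = \<omega> ^ dlog x" for x
  have dlog: "x = h [^] dlog x" if "x \<in> generate G {h}" for x
    using that unfolding gen dlog_def by (auto intro: someI)
  have \<omega>N: "\<omega> ^ N = 1" using N by (simp add: \<omega>_def DeMoivre)
  have \<omega>_mod: "\<omega> ^ k = \<omega> ^ (k mod N)" for k
  proof -
    have "\<omega> ^ k = \<omega> ^ (N * (k div N) + k mod N)" by simp
    also have "\<dots> = \<omega> ^ (k mod N)" unfolding power_add power_mult \<omega>N by simp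
    finally show ?thesis .
  qed
  have \<omega>_eq: "\<omega> ^ i = \<omega> ^ j \<longleftrightarrow> i mod N = j mod N" for i j
  proof
    assume "\<omega> ^ i = \<omega> ^ j"
    \<comment> \<open>Exponents are reduced first because they enumerate the \<open>N\<close>-th
      roots of unity injectively only below \<open>N\<close>.\<close>
    then have "\<omega> ^ (i mod N) = \<omega> ^ (j mod N)" using \<omega>_mod[of i] \<omega>_mod[of j] by simp
    then have "cis (2 * pi * real (i mod N) / real N) = cis (2 * pi * real (j mod N) / real N)"
      by (simp add: \<omega>_def DeMoivre mult_ac)
    then show "i mod N = j mod N"
      using bij_betw_roots_unity[OF N] N unfolding bij_betw_def inj_on_def by auto
  qed (metis \<omega>_mod)
  have h_eq: "h [^] i = h [^] j \<longleftrightarrow> i mod N = j mod N" for i j :: nat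
  proof -
    have "h [^] i = h [^] j \<longleftrightarrow> int N dvd int j - int i"
      using int_pow_eq[OF h, of "int i" "int j"] by (simp add: int_pow_int N_def)
    also have "\<dots> \<longleftrightarrow> int j mod int N = int i mod int N" by (rule mod_eq_dvd_iff[symmetric])
    also have "\<dots> \<longleftrightarrow> i mod N = j mod N" by (metis of_nat_eq_iff zmod_int)
    finally show ?thesis .
  qed
  show thesis
  proof
    show "N > 0" by (rule N)
    show "e x ^ N = 1" for x
      using \<omega>N by (simp add: e_def) (metis power_commutes power_mult power_one mult.commute)
    show "norm (e x) = 1" for x by (simp add: e_def \<omega>_def norm_power)
    show "e (x \<otimes> y) = e x * e y" if xy: "x \<in> generate G {h}" "y \<in> generate G {h}" for x y
    proof -
      have "h [^] (dlog x + dlog y) = x \<otimes> y"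
        using dlog[OF xy(1)] dlog[OF xy(2)] h by (simp flip: nat_pow_mult)
      then have "x \<otimes> y = h [^] (dlog x + dlog y)" by simp
      moreover from this have "x \<otimes> y = h [^] dlog (x \<otimes> y)" unfolding dlog_def by (rule someI)
      ultimately have "dlog (x \<otimes> y) mod N = (dlog x + dlog y) mod N" using h_eq by metis
      then have "\<omega> ^ dlog (x \<otimes> y) = \<omega> ^ (dlog x + dlog y)" using \<omega>_eq by blast
      then show ?thesis by (simp add: e_def power_add)
    qed
    show "inj_on e (generate G {h})"
      unfolding inj_on_def e_def \<omega>_eq using h_eq dlog by metis
  qed
qed

end

section \<open>Fourier inversion for roots of unity, and plane rotations\<close>

lemma sum_powers_root_of_unity:
  fixes u :: complex
  assumes "u ^ N = 1"
  shows "(\<Sum>k<N. u ^ k) = of_nat (if u = 1 then N else 0)"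
  using geometric_sum[of u N] assms by auto

text \<open>A geometric sum in \<open>u / v\<close>. With \<open>u = e x\<close> and
  \<open>v = e h\<close> it is Fourier inversion on a cyclic group: the coefficients
  \<open>(1 / v) ^ k\<close> isolate the elements at which \<open>e\<close> has the same value as at
  \<open>h\<close>.\<close>

lemma sum_character_orthogonality:
  fixes u v :: complex
  assumes "u ^ N = 1" "v ^ N = 1" "N > 0"
  shows "(\<Sum>k<N. (1 / v) ^ k * u ^ k) = of_nat (if u = v then N else 0)"
proof -
  have "v \<noteq> 0" using assms by (metis power_0_left zero_neq_one less_numeral_extra(3))
  then have "(\<Sum>k<N. (1 / v) ^ k * u ^ k) = (\<Sum>k<N. (u / v) ^ k)"
    by (intro sum.cong refl) (simp add: power_divide)
  also have "\<dots> = of_nat (if u / v = 1 then N else 0)"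
    using assms by (intro sum_powers_root_of_unity) (simp add: power_divide)
  finally show ?thesis using \<open>v \<noteq> 0\<close> by simp
qed

text \<open>The real matrix of multiplication by \<open>z\<close> on the plane, a rotation when
  \<open>norm z = 1\<close>. The entries are embedded by \<open>of_real\<close> so that real
  representations fit the type of complex ones.\<close>

definition rotation_mat :: "complex \<Rightarrow> complex mat" where
  "rotation_mat z = mat 2 2 (\<lambda>(i, j). of_real (if i = j then Re z else if i = 0 then - Im z else Im z))"

lemma rotation_mat_mult: "rotation_mat (z * w) = rotation_mat z * rotation_mat w"
proof (rule eq_matI)
  fix i j assume "i < dim_row (rotation_mat z * rotation_mat w)" "j < dim_col (rotation_mat z * rotation_mat w)"
  then have "i < 2" "j < 2" by (auto simp: rotation_mat_def)
  then show "rotation_mat (z * w) $$ (i, j) = (rotation_mat z * rotation_mat w) $$ (i, j)"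
    by (auto simp: rotation_mat_def scalar_prod_def numeral_2_eq_2 less_Suc_eq)
qed (auto simp: rotation_mat_def)

lemma rotation_mat_one: "rotation_mat 1 = 1\<^sub>m 2"
  by (rule eq_matI) (auto simp: rotation_mat_def)

lemma mat_trace_rotation_mat: "mat_trace (rotation_mat z) = z + cnj z"
  by (simp add: mat_trace_def rotation_mat_def numeral_2_eq_2 complex_eq_iff)

section \<open>Injectivity of induction forces trivial fusion\<close>

lemma (in group) conj_generate_subset:
  assumes fin: "finite (carrier G)" and H: "subgroup H G" and t: "t \<in> carrier G" and h: "h \<in> carrier G"
    and y: "t \<otimes> h \<otimes> inv t \<in> H"
  shows "{z \<in> carrier G. inv t \<otimes> z \<otimes> t \<in> generate G {h}} \<subseteq> H"
proof
  interpret H: subgroup H G by fact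
  fix z assume "z \<in> {z \<in> carrier G. inv t \<otimes> z \<otimes> t \<in> generate G {h}}"
  then obtain k :: nat where z: "z \<in> carrier G" "inv t \<otimes> z \<otimes> t = h [^] k"
    unfolding generate_pow_on_finite_carrier[OF fin h] by auto
  \<comment> \<open>The conjugate of a power of \<open>h\<close> is the same power of the conjugate,
    a product of elements of \<open>H\<close>.\<close>
  have "t \<otimes> h [^] k \<otimes> inv t \<in> H" for k :: nat
  proof (induction k)
    case (Suc k)
    have "(t \<otimes> h [^] k \<otimes> inv t) \<otimes> (t \<otimes> h \<otimes> inv t) \<in> H" using Suc y by simp
    then show ?case using t h by (simp add: m_assoc mult_inv_cancel)
  qed (use t in simp)
  from this[of k] show "z \<in> H"
    unfolding z(2)[symmetric] using t z(1) by (simp add: m_assoc mult_inv_cancel)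
qed

text \<open>The powers \<open>V k\<close> of the linear character \<open>e\<close> combine to
  \<open>N\<close> times the indicator of \<open>h\<close> on the subgroup generated by
  \<open>h\<close>. So the conjugate that \<open>exists_conj_of_ind_fun_eq\<close> finds with
  nonzero weight is \<open>h\<close> itself.\<close>

lemma (in group) ind_R_mono_imp_fusion:
  assumes fin: "finite (carrier G)" and H: "subgroup H G" and mono: "ind_R_mono G H"
    and h: "h \<in> H" and t: "t \<in> carrier G" and y: "t \<otimes> h \<otimes> inv t \<in> H"
  shows "\<exists>x\<in>H. inv x \<otimes> (t \<otimes> h \<otimes> inv t) \<otimes> x = h"
proof -
  interpret H: subgroup H G by fact
  have hG: "h \<in> carrier G" using h by simp
  define C where "C = generate G {h}"
  have C: "subgroup C G" unfolding C_def using hG by (intro generate_is_subgroup) auto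
  have CH: "C \<subseteq> H" unfolding C_def using h H by (intro generate_subgroup_incl) auto
  have CH': "{z \<in> carrier G. inv t \<otimes> z \<otimes> t \<in> C} \<subseteq> H"
    unfolding C_def by (rule conj_generate_subset[OF fin H t hG y])
  have hC: "h \<in> C" unfolding C_def by (rule generate.incl) simp
  obtain e N where N: "N > 0" and eN: "\<And>x. x \<in> C \<Longrightarrow> e x ^ N = (1::complex)"
    and emult: "\<And>x y. x \<in> C \<Longrightarrow> y \<in> C \<Longrightarrow> e (x \<otimes> y) = e x * e y" and inj: "inj_on e C"
    unfolding C_def by (rule cyclic_character[OF fin hG]) blast
  have K: "group (G\<lparr>carrier := H\<rparr>)" by (rule subgroup_imp_group[OF H])
  have finH: "finite (carrier (G\<lparr>carrier := H\<rparr>))" using fin H.subset finite_subset by auto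
  have e1: "e \<one> = 1"
  proof -
    have "e \<one> * e \<one> = e \<one>" using emult[of \<one> \<one>] subgroup.one_closed[OF C] by simp
    moreover have "e \<one> \<noteq> 0" using eN[of \<one>] N subgroup.one_closed[OF C] by (auto simp: power_0_left)
    ultimately show ?thesis by simp
  qed
  define V where "V k = (1::nat, \<lambda>x. mat 1 1 (\<lambda>_. e x ^ k))" for k :: nat
  have V: "is_rep (G\<lparr>carrier := C\<rparr>) (V k)" for k
    by (auto simp: is_rep_def V_def e1 emult power_mult_distrib scalar_prod_def intro!: eq_matI)
  have chi: "character (V k) x = e x ^ k" for k x
    by (simp add: character_def mat_trace_def V_def)
  have "\<exists>x\<in>H. inv x \<otimes> (t \<otimes> h \<otimes> inv t) \<otimes> x \<in> C \<and>
      (if e (inv x \<otimes> (t \<otimes> h \<otimes> inv t) \<otimes> x) = e h then N else 0) \<noteq> 0"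
  proof (rule exists_conj_of_ind_fun_eq[OF C t fin H _ _ hC _ y,
        where f = "\<lambda>k. character (V k)" and c = "\<lambda>k. (1 / e h) ^ k" and N = N])
    show "(\<Sum>k<N. (1 / e h) ^ k * character (V k) x) = of_nat (if e x = e h then N else 0)" if "x \<in> C" for x
      using sum_character_orthogonality[OF eN[OF that] eN[OF hC] N] by (simp add: chi)
    show "(if e h = e h then N else 0) \<noteq> 0" using N by simp
    fix k z assume z: "z \<in> H"
    show "ind_fun (G\<lparr>carrier := H\<rparr>) C (character (V k)) z =
        ind_fun (G\<lparr>carrier := H\<rparr>) {z \<in> carrier G. inv t \<otimes> z \<otimes> t \<in> C}
          (\<lambda>z. character (V k) (inv t \<otimes> z \<otimes> t)) z"
    proof (rule ind_conj_cancel[OF C t fin H CH CH' V _ z])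
      assume g: "groth_eq G (induce G H (induce (G\<lparr>carrier := H\<rparr>) C (V k)), induce G H (induce (G\<lparr>carrier := H\<rparr>) C (V k)))
        (induce G H (induce (G\<lparr>carrier := H\<rparr>) {z \<in> carrier G. inv t \<otimes> z \<otimes> t \<in> C} (conj_rep G t (V k))),
         induce G H (induce (G\<lparr>carrier := H\<rparr>) C (V k)))"
      have "is_rep (G\<lparr>carrier := H\<rparr>) (induce (G\<lparr>carrier := H\<rparr>) C (V k))"
        using V by (intro group.is_rep_induce[OF K finH]) (auto intro: subgroup_incl[OF C H CH])
      moreover have "is_rep (G\<lparr>carrier := H\<rparr>)
          (induce (G\<lparr>carrier := H\<rparr>) {z \<in> carrier G. inv t \<otimes> z \<otimes> t \<in> C} (conj_rep G t (V k)))"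
        using is_rep_conj_rep[OF C t V]
        by (intro group.is_rep_induce[OF K finH]) (auto intro: subgroup_incl[OF conj_subgroup[OF C t] H CH'])
      ultimately show "groth_eq (G\<lparr>carrier := H\<rparr>)
         (induce (G\<lparr>carrier := H\<rparr>) C (V k), induce (G\<lparr>carrier := H\<rparr>) C (V k))
         (induce (G\<lparr>carrier := H\<rparr>) {z \<in> carrier G. inv t \<otimes> z \<otimes> t \<in> C} (conj_rep G t (V k)),
          induce (G\<lparr>carrier := H\<rparr>) C (V k))"
        using mono g unfolding ind_R_mono_def by blast
    qed
  qed
  then show ?thesis using inj hC by (auto simp: inj_on_def split: if_splits)
qed

text \<open>Characters of real representations take equal values at an element and its inverse, so
  the rotations \<open>V k\<close> yield only an indicator symmetrised under inversion, and the
  conjugate found is \<open>h\<close> or \<open>inv h\<close>.\<close>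

lemma (in group) ind_RO_mono_imp_fusion:
  assumes fin: "finite (carrier G)" and H: "subgroup H G" and mono: "ind_RO_mono G H"
    and h: "h \<in> H" and t: "t \<in> carrier G" and y: "t \<otimes> h \<otimes> inv t \<in> H"
  shows "\<exists>x\<in>H. inv x \<otimes> (t \<otimes> h \<otimes> inv t) \<otimes> x \<in> {h, inv h}"
proof -
  interpret H: subgroup H G by fact
  have hG: "h \<in> carrier G" using h by simp
  define C where "C = generate G {h}"
  have C: "subgroup C G" unfolding C_def using hG by (intro generate_is_subgroup) auto
  have CH: "C \<subseteq> H" unfolding C_def using h H by (intro generate_subgroup_incl) auto
  have CH': "{z \<in> carrier G. inv t \<otimes> z \<otimes> t \<in> C} \<subseteq> H"
    unfolding C_def by (rule conj_generate_subset[OF fin H t hG y])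
  have hC: "h \<in> C" unfolding C_def by (rule generate.incl) simp
  obtain e N where N: "N > 0" and eN: "\<And>x. x \<in> C \<Longrightarrow> e x ^ N = (1::complex)"
    and enorm: "\<And>x. x \<in> C \<Longrightarrow> norm (e x) = 1"
    and emult: "\<And>x y. x \<in> C \<Longrightarrow> y \<in> C \<Longrightarrow> e (x \<otimes> y) = e x * e y" and inj: "inj_on e C"
    unfolding C_def by (rule cyclic_character[OF fin hG]) blast
  have K: "group (G\<lparr>carrier := H\<rparr>)" by (rule subgroup_imp_group[OF H])
  have finH: "finite (carrier (G\<lparr>carrier := H\<rparr>))" using fin H.subset finite_subset by auto
  have e1: "e \<one> = 1"
  proof -
    have "e \<one> * e \<one> = e \<one>" using emult[of \<one> \<one>] subgroup.one_closed[OF C] by simp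
    moreover have "e \<one> \<noteq> 0" using enorm[of \<one>] subgroup.one_closed[OF C] by auto
    ultimately show ?thesis by simp
  qed
  \<comment> \<open>Both \<open>e (inv x)\<close> and \<open>cnj (e x)\<close> are inverse to
    \<open>e x\<close>, the latter because \<open>e x\<close> has norm 1.\<close>
  have einv: "cnj (e x) = e (inv x)" if x: "x \<in> C" for x
  proof -
    have xi: "inv x \<in> C" "x \<in> carrier G"
      using x subgroup.m_inv_closed[OF C] subgroup.mem_carrier[OF C] by auto
    have "e x * e (inv x) = 1" using emult[OF x xi(1)] xi e1 by simp
    moreover have "e x * cnj (e x) = 1" using enorm[OF x] complex_norm_square[of "e x"] by simp
    ultimately show ?thesis by (metis mult_cancel_left mult_zero_left zero_neq_one)
  qed
  define V where "V k = (2::nat, \<lambda>x. rotation_mat (e x ^ k))" for k :: nat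
  have V: "is_real_rep (G\<lparr>carrier := C\<rparr>) (V k)" for k
    unfolding is_real_rep_def is_rep_def
    by (auto simp: V_def e1 emult power_mult_distrib rotation_mat_mult rotation_mat_one)
      (auto simp: rotation_mat_def)
  then have V': "is_rep (G\<lparr>carrier := C\<rparr>) (V k)" for k by (simp add: is_real_rep_def)
  have chi: "character (V k) x = e x ^ k + e (inv x) ^ k" if "x \<in> C" for k x
    using einv[OF that] by (simp add: character_def V_def mat_trace_rotation_mat)
  \<comment> \<open>The two terms add up when \<open>h\<close> is its own inverse; only the place
    where \<open>w\<close> is nonzero enters the argument.\<close>
  define w where "w x = (if e x = e h then N else 0) + (if e (inv x) = e h then N else 0)" for x
  have "\<exists>x\<in>H. inv x \<otimes> (t \<otimes> h \<otimes> inv t) \<otimes> x \<in> C \<and> w (inv x \<otimes> (t \<otimes> h \<otimes> inv t) \<otimes> x) \<noteq> 0"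
  proof (rule exists_conj_of_ind_fun_eq[OF C t fin H _ _ hC _ y,
        where f = "\<lambda>k. character (V k)" and c = "\<lambda>k. (1 / e h) ^ k" and N = N])
    show "(\<Sum>k<N. (1 / e h) ^ k * character (V k) x) = of_nat (w x)" if x: "x \<in> C" for x
    proof -
      have xi: "inv x \<in> C" using x subgroup.m_inv_closed[OF C] by blast
      show ?thesis
        using sum_character_orthogonality[OF eN[OF x] eN[OF hC] N]
          sum_character_orthogonality[OF eN[OF xi] eN[OF hC] N]
        by (simp add: chi[OF x] w_def distrib_left sum.distrib)
    qed
    show "w h \<noteq> 0" using N by (simp add: w_def)
    fix k z assume z: "z \<in> H"
    show "ind_fun (G\<lparr>carrier := H\<rparr>) C (character (V k)) z =
        ind_fun (G\<lparr>carrier := H\<rparr>) {z \<in> carrier G. inv t \<otimes> z \<otimes> t \<in> C}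
          (\<lambda>z. character (V k) (inv t \<otimes> z \<otimes> t)) z"
    proof (rule ind_conj_cancel[OF C t fin H CH CH' V' _ z])
      assume g: "groth_eq G (induce G H (induce (G\<lparr>carrier := H\<rparr>) C (V k)), induce G H (induce (G\<lparr>carrier := H\<rparr>) C (V k)))
        (induce G H (induce (G\<lparr>carrier := H\<rparr>) {z \<in> carrier G. inv t \<otimes> z \<otimes> t \<in> C} (conj_rep G t (V k))),
         induce G H (induce (G\<lparr>carrier := H\<rparr>) C (V k)))"
      have "is_real_rep (G\<lparr>carrier := H\<rparr>) (induce (G\<lparr>carrier := H\<rparr>) C (V k))"
        using V by (intro group.is_real_rep_induce[OF K finH]) (auto intro: subgroup_incl[OF C H CH])
      moreover have "is_real_rep (G\<lparr>carrier := H\<rparr>)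
          (induce (G\<lparr>carrier := H\<rparr>) {z \<in> carrier G. inv t \<otimes> z \<otimes> t \<in> C} (conj_rep G t (V k)))"
        using is_real_rep_conj_rep[OF C t V]
        by (intro group.is_real_rep_induce[OF K finH]) (auto intro: subgroup_incl[OF conj_subgroup[OF C t] H CH'])
      ultimately show "groth_eq (G\<lparr>carrier := H\<rparr>)
         (induce (G\<lparr>carrier := H\<rparr>) C (V k), induce (G\<lparr>carrier := H\<rparr>) C (V k))
         (induce (G\<lparr>carrier := H\<rparr>) {z \<in> carrier G. inv t \<otimes> z \<otimes> t \<in> C} (conj_rep G t (V k)),
          induce (G\<lparr>carrier := H\<rparr>) C (V k))"
        using mono g unfolding ind_RO_mono_def by blast
    qed
  qed
  then obtain x where x: "x \<in> H" "inv x \<otimes> (t \<otimes> h \<otimes> inv t) \<otimes> x \<in> C"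
    and wx: "w (inv x \<otimes> (t \<otimes> h \<otimes> inv t) \<otimes> x) \<noteq> 0" by blast
  define z where "z = inv x \<otimes> (t \<otimes> h \<otimes> inv t) \<otimes> x"
  have z: "z \<in> C" "inv z \<in> C" "z \<in> carrier G"
    using x(2) subgroup.m_inv_closed[OF C] subgroup.mem_carrier[OF C] by (auto simp: z_def)
  have "e z = e h \<or> e (inv z) = e h" using wx by (auto simp: w_def z_def split: if_splits)
  then have "z = h \<or> inv z = h" using inj z hC by (auto simp: inj_on_def)
  then have "z \<in> {h, inv h}" using z(3) by auto
  then show ?thesis using x(1) by (auto simp: z_def)
qed

section \<open>Trivial fusion implies injectivity of induction\<close>

lemma (in group) ind_fun_eq_0_imp:
  assumes fin: "finite (carrier G)" and H: "subgroup H G" and h: "h \<in> H"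
    and const: "\<And>x. x \<in> carrier G \<Longrightarrow> inv x \<otimes> h \<otimes> x \<in> H \<Longrightarrow> f (inv x \<otimes> h \<otimes> x) = f h"
    and zero: "ind_fun G H f h = 0"
  shows "f h = 0"
proof -
  interpret H: subgroup H G by fact
  have "finite H" using fin H.subset finite_subset by blast
  then have cardH: "card H \<noteq> 0" using H.one_closed by (metis card_0_eq empty_iff)
  \<comment> \<open>\<open>S\<close> indexes the summands that survive. By constancy each of them is
    \<open>f h\<close>, and the identity belongs to \<open>S\<close>, so the induced value is a
    positive multiple of \<open>f h\<close>.\<close>
  define S where "S = {x \<in> carrier G. inv x \<otimes> h \<otimes> x \<in> H}"
  have "\<one> \<in> S" "finite S" using h fin by (auto simp: S_def)
  then have cardS: "card S \<noteq> 0" by (metis card_0_eq empty_iff)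
  have "ind_fun G H f h = (\<Sum>x\<in>carrier G. if inv x \<otimes> h \<otimes> x \<in> H then f h else 0) / of_nat (card H)"
    unfolding ind_fun_def using const by (intro arg_cong2[of _ _ _ _ "(/)"] sum.cong) auto
  also have "(\<Sum>x\<in>carrier G. if inv x \<otimes> h \<otimes> x \<in> H then f h else 0) = of_nat (card S) * f h"
    using fin by (simp add: S_def sum.If_cases Int_def)
  finally show ?thesis using zero cardH cardS by simp
qed

lemma (in group) groth_eq_induce_imp:
  assumes fin: "finite (carrier G)" and H: "subgroup H G"
    and V: "is_rep (G\<lparr>carrier := H\<rparr>) V" and W: "is_rep (G\<lparr>carrier := H\<rparr>) W"
    and V': "is_rep (G\<lparr>carrier := H\<rparr>) V'" and W': "is_rep (G\<lparr>carrier := H\<rparr>) W'"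
    and eq: "groth_eq G (induce G H V, induce G H W) (induce G H V', induce G H W')"
    and const: "\<And>U h x. U \<in> {V, W, V', W'} \<Longrightarrow> h \<in> H \<Longrightarrow> x \<in> carrier G \<Longrightarrow> inv x \<otimes> h \<otimes> x \<in> H \<Longrightarrow>
      character U (inv x \<otimes> h \<otimes> x) = character U h"
  shows "groth_eq (G\<lparr>carrier := H\<rparr>) (V, W) (V', W')"
proof -
  interpret H: subgroup H G by fact
  have K: "group (G\<lparr>carrier := H\<rparr>)" by (rule subgroup_imp_group[OF H])
  have finH: "finite (carrier (G\<lparr>carrier := H\<rparr>))" using fin H.subset finite_subset by auto
  \<comment> \<open>The difference to be shown zero on \<open>H\<close>; constancy under fusion
    passes to it from the four characters.\<close>
  define f where "f x = character V x + character W' x - character V' x - character W x" for x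
  have "f h = 0" if h: "h \<in> H" for h
  proof (rule ind_fun_eq_0_imp[OF fin H h])
    show "f (inv x \<otimes> h \<otimes> x) = f h" if "x \<in> carrier G" "inv x \<otimes> h \<otimes> x \<in> H" for x
      using const[OF _ h that] by (simp add: f_def)
    have hG: "h \<in> carrier G" using h by simp
    have "character (induce G H V) h + character (induce G H W') h =
        character (induce G H V') h + character (induce G H W) h"
      using eq hG V W V' W' by (simp add: groth_eq_iff_character[OF is_group fin] is_rep_induce[OF fin H])
    then have "ind_fun G H (character V) h + ind_fun G H (character W') h =
        ind_fun G H (character V') h + ind_fun G H (character W) h"
      using hG V W V' W' by (simp add: character_induce[OF fin H])
    moreover have "ind_fun G H f h = ind_fun G H (character V) h + ind_fun G H (character W') h
        - ind_fun G H (character V') h - ind_fun G H (character W) h"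
      unfolding ind_fun_def f_def diff_divide_distrib[symmetric] add_divide_distrib[symmetric]
        sum_subtractf[symmetric] sum.distrib[symmetric]
      by (intro arg_cong2[of _ _ _ _ "(/)"] sum.cong) auto
    ultimately show "ind_fun G H f h = 0" by simp
  qed
  then show ?thesis
    using V W V' W' by (auto simp: groth_eq_iff_character[OF K finH] f_def algebra_simps)
qed

section \<open>Conjugacy classes of a subgroup and the two equivalences\<close>

lemma (in group) conj_class_subgroup:
  assumes "subgroup H G"
  shows "conj_class (G\<lparr>carrier := H\<rparr>) h = {x \<otimes> h \<otimes> inv x | x. x \<in> H}"
  by (simp add: conj_class_def m_inv_consistent[OF assms] cong: rev_conj_cong)

context group
begin

context
  fixes H
  assumes fin: "finite (carrier G)" and H: "subgroup H G"
begin

lemma conj_class_subgroup_subset: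
  assumes "h \<in> H"
  shows "conj_class (G\<lparr>carrier := H\<rparr>) h \<subseteq> conj_class G h \<inter> H"
proof -
  interpret H: subgroup H G by (rule H)
  show ?thesis using assms unfolding conj_class_subgroup[OF H] by (auto simp: conj_class_def)
qed

lemma mem_conj_class_subgroup:
  assumes "x \<in> H" "z \<in> H"
  shows "z \<in> conj_class (G\<lparr>carrier := H\<rparr>) (inv x \<otimes> z \<otimes> x)"
proof -
  interpret H: subgroup H G by (rule H)
  have "x \<otimes> (inv x \<otimes> z \<otimes> x) \<otimes> inv x = z"
    using assms by (simp add: m_assoc mult_inv_cancel)
  then show ?thesis unfolding conj_class_subgroup[OF H] using assms(1) by (auto intro!: exI[of _ x])
qed

lemma conj_mem_conj_class: "x \<in> carrier G \<Longrightarrow> inv x \<otimes> h \<otimes> x \<in> conj_class G h"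
  by (auto simp: conj_class_def intro!: exI[of _ "inv x"])

lemma character_conj_class:
  assumes U: "is_rep (G\<lparr>carrier := H\<rparr>) U" and h: "h \<in> H" and z: "z \<in> conj_class (G\<lparr>carrier := H\<rparr>) h"
  shows "character U z = character U h"
proof -
  interpret H: subgroup H G by (rule H)
  obtain y where y: "y \<in> H" "z = y \<otimes> h \<otimes> inv y" using z by (auto simp: conj_class_subgroup[OF H])
  then show ?thesis
    using character_conj[OF subgroup_imp_group[OF H] U, of "inv y" h] h by (simp add: m_inv_consistent[OF H])
qed

lemma ind_R_mono_iff:
  "ind_R_mono G H \<longleftrightarrow> (\<forall>h\<in>H. conj_class G h \<inter> H = conj_class (G\<lparr>carrier := H\<rparr>) h)"
proof (intro iffI ballI)
  fix h assume mono: "ind_R_mono G H" and h: "h \<in> H"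
  \<comment> \<open>The reverse inclusion holds for every subgroup, so injectivity enters only
    here.\<close>
  have "conj_class G h \<inter> H \<subseteq> conj_class (G\<lparr>carrier := H\<rparr>) h"
  proof
    fix z assume "z \<in> conj_class G h \<inter> H"
    then obtain t where t: "t \<in> carrier G" "z = t \<otimes> h \<otimes> inv t" and z: "z \<in> H"
      by (auto simp: conj_class_def)
    obtain x where "x \<in> H" "inv x \<otimes> z \<otimes> x = h"
      using ind_R_mono_imp_fusion[OF fin H mono h t(1)] z t(2) by blast
    then show "z \<in> conj_class (G\<lparr>carrier := H\<rparr>) h" using mem_conj_class_subgroup z by metis
  qed
  then show "conj_class G h \<inter> H = conj_class (G\<lparr>carrier := H\<rparr>) h" using conj_class_subgroup_subset[OF h] by blast
next
  assume cl: "\<forall>h\<in>H. conj_class G h \<inter> H = conj_class (G\<lparr>carrier := H\<rparr>) h"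
  show "ind_R_mono G H"
    unfolding ind_R_mono_def
  proof (intro allI impI, elim conjE)
    fix V W V' W'
    assume reps: "is_rep (G\<lparr>carrier := H\<rparr>) V" "is_rep (G\<lparr>carrier := H\<rparr>) W"
      "is_rep (G\<lparr>carrier := H\<rparr>) V'" "is_rep (G\<lparr>carrier := H\<rparr>) W'"
      and eq: "groth_eq G (induce G H V, induce G H W) (induce G H V', induce G H W')"
    show "groth_eq (G\<lparr>carrier := H\<rparr>) (V, W) (V', W')"
    proof (rule groth_eq_induce_imp[OF fin H reps eq])
      fix U h x assume U: "U \<in> {V, W, V', W'}" and h: "h \<in> H"
        and x: "x \<in> carrier G" "inv x \<otimes> h \<otimes> x \<in> H"
      have "inv x \<otimes> h \<otimes> x \<in> conj_class (G\<lparr>carrier := H\<rparr>) h" using conj_mem_conj_class[OF x(1)] x(2) cl h by blast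
      then show "character U (inv x \<otimes> h \<otimes> x) = character U h" using character_conj_class[OF _ h] U reps by blast
    qed
  qed
qed

lemma ind_RO_mono_iff:
  "ind_RO_mono G H \<longleftrightarrow> (\<forall>h\<in>H. real_conj_class G h \<inter> H = real_conj_class (G\<lparr>carrier := H\<rparr>) h)"
proof (intro iffI ballI)
  interpret H: subgroup H G by (rule H)
  fix h assume mono: "ind_RO_mono G H" and h: "h \<in> H"
  \<comment> \<open>\<open>k\<close> covers the two classes that form the real class. Fusion returns
    \<open>k\<close> or its inverse, and either one is again \<open>h\<close> or
    \<open>inv h\<close>.\<close>
  have *: "z \<in> real_conj_class (G\<lparr>carrier := H\<rparr>) h" if z: "z \<in> conj_class G k" "z \<in> H" and k: "k \<in> {h, inv h}" for z k
  proof -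
    obtain t where t: "t \<in> carrier G" "z = t \<otimes> k \<otimes> inv t"
      using z(1) by (auto simp: conj_class_def)
    have kH: "k \<in> H" using k h by auto
    obtain x where x: "x \<in> H" "inv x \<otimes> z \<otimes> x \<in> {k, inv k}"
      using ind_RO_mono_imp_fusion[OF fin H mono kH t(1)] z(2) t(2) by blast
    then have "inv x \<otimes> z \<otimes> x \<in> {h, inv h}" using k h by auto
    then show ?thesis
      using mem_conj_class_subgroup[OF x(1) z(2)] by (auto simp: real_conj_class_def m_inv_consistent[OF H h])
  qed
  show "real_conj_class G h \<inter> H = real_conj_class (G\<lparr>carrier := H\<rparr>) h"
  proof
    show "real_conj_class G h \<inter> H \<subseteq> real_conj_class (G\<lparr>carrier := H\<rparr>) h"
      using * by (auto simp: real_conj_class_def[of G])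
    show "real_conj_class (G\<lparr>carrier := H\<rparr>) h \<subseteq> real_conj_class G h \<inter> H"
      using conj_class_subgroup_subset[OF h] conj_class_subgroup_subset[of "inv h"] h by (auto simp: real_conj_class_def m_inv_consistent[OF H h])
  qed
next
  interpret H: subgroup H G by (rule H)
  assume cl: "\<forall>h\<in>H. real_conj_class G h \<inter> H = real_conj_class (G\<lparr>carrier := H\<rparr>) h"
  show "ind_RO_mono G H"
    unfolding ind_RO_mono_def
  proof (intro allI impI, elim conjE)
    fix V W V' W'
    assume reps: "is_real_rep (G\<lparr>carrier := H\<rparr>) V" "is_real_rep (G\<lparr>carrier := H\<rparr>) W"
      "is_real_rep (G\<lparr>carrier := H\<rparr>) V'" "is_real_rep (G\<lparr>carrier := H\<rparr>) W'"
      and eq: "groth_eq G (induce G H V, induce G H W) (induce G H V', induce G H W')"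
    note reps' = reps[unfolded is_real_rep_def, THEN conjunct1]
    show "groth_eq (G\<lparr>carrier := H\<rparr>) (V, W) (V', W')"
    proof (rule groth_eq_induce_imp[OF fin H reps' eq])
      fix U h x assume U: "U \<in> {V, W, V', W'}" and h: "h \<in> H"
        and x: "x \<in> carrier G" "inv x \<otimes> h \<otimes> x \<in> H"
      have Ureal: "is_real_rep (G\<lparr>carrier := H\<rparr>) U" using U reps by blast
      then have Urep: "is_rep (G\<lparr>carrier := H\<rparr>) U" by (simp add: is_real_rep_def)
      \<comment> \<open>A real trace is its own conjugate, and by \<open>character_inv\<close>
        conjugation of the value is inversion of the argument; so the character is constant on the
        real class of \<open>h\<close> in \<open>H\<close>.\<close>
      have "mat_trace (snd U h) \<in> \<real>"
        using Ureal h is_rep_carrier[OF Urep, of h] by (auto simp: is_real_rep_def mat_trace_def intro!: sum_in_Reals)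
      then have "cnj (character U h) = character U h" by (simp add: character_def Reals_cnj_iff)
      then have inv_char: "character U (inv h) = character U h"
        using character_inv[OF Urep subgroup_imp_group[OF H] _, of h] finite_subset[OF H.subset fin] h by (simp add: m_inv_consistent[OF H])
      have "inv x \<otimes> h \<otimes> x \<in> real_conj_class (G\<lparr>carrier := H\<rparr>) h"
        using conj_mem_conj_class[OF x(1)] x(2) cl h by (auto simp: real_conj_class_def[of G])
      then have "inv x \<otimes> h \<otimes> x \<in> conj_class (G\<lparr>carrier := H\<rparr>) h \<or>
          inv x \<otimes> h \<otimes> x \<in> conj_class (G\<lparr>carrier := H\<rparr>) (inv h)"
        by (simp add: real_conj_class_def m_inv_consistent[OF H h])
      then show "character U (inv x \<otimes> h \<otimes> x) = character U h"
        using character_conj_class[OF Urep h] character_conj_class[OF Urep, of "inv h"] h inv_char by auto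
    qed
  qed
qed

end

end

theorem theoremA:
  fixes G :: "'g monoid" and H :: "'g set"
  assumes "group G" and "finite (carrier G)" and "subgroup H G"
  shows "(ind_R_mono G H \<longleftrightarrow>
            (\<forall>h\<in>H. conj_class G h \<inter> H = conj_class (G\<lparr>carrier := H\<rparr>) h))
       \<and> (ind_RO_mono G H \<longleftrightarrow>
            (\<forall>h\<in>H. real_conj_class G h \<inter> H = real_conj_class (G\<lparr>carrier := H\<rparr>) h))"
  using group.ind_R_mono_iff[OF assms] group.ind_RO_mono_iff[OF assms] by blast

end
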